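(* Let $n\ge 7$ be an integer. Then $$ex(n,\mathscr{F}_{n-3})=\frac{n(n-1)}{2}-2.$$ Moreover, a digraph $D$ is in $Ex(n,\mathscr{F}_{n-3})$ if and only if its adjacency matrix $A_D$ is permutation similar to $$F_n=\begin{bmatrix} 0&J_{2,n-4}&J_{2,2}\\ 0&T_{n-4}&J_{n-4,2}\\ 0&0&0\end{bmatrix}.$$
   Context: Digraphs here have no parallel arcs but may have loops (a loop counts as an arc). A walk of length $k$ from $u$ to $v$ is a sequence of vertices $u=v_0,\dots,v_k=v$ with each $(v_{i-1},v_i)$ an arc. A digraph is $\mathscr{F}_k$-free if for every ordered pair of vertices $(i,j)$ there is at most one walk of length $k$ from $i$ to $j$. $ex(n,\mathscr{F}_k)$ is the maximum number of arcs of an $\mathscr{F}_k$-free digraph of order $n$ (loops allowed), and $Ex(n,\mathscr{F}_k)$ is the set of $\mathscr{F}_k$-free digraphs of order $n$ attaining this maximum. $A_D=(a_{ij})$ is the adjacency matrix ($a_{ij}=1$ iff $(v_i,v_j)$ is an arc). Matrices $A,B$ are permutation similar if $B=PAP^T$ for a permutation matrix $P$. $T_m$ is the $m\times m$ matrix with $(i,j)$-entry $1$ if $i<j$ and $0$ otherwise; $J_{a,b}$ is the $a\times b$ all-ones matrix; blocks $0$ are zero matrices (the diagonal zero blocks are $2\times 2$). *)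

theory Defs
  imports "Jordan_Normal_Form.Matrix" "Graph_Theory.Graph_Theory"
begin

text \<open>
  Digraphs without parallel arcs but possibly with loops are the finite pair digraphs
  (\<^locale>\<open>pair_fin_digraph\<close>). Walks are given by their vertex sequences; a walk of length
  \<open>k\<close> is a list of \<open>k + 1\<close> vertices.
\<close>

definition walk_of_length :: "'a pair_pre_digraph \<Rightarrow> nat \<Rightarrow> 'a \<Rightarrow> 'a \<Rightarrow> 'a list \<Rightarrow> bool" where
  "walk_of_length D k u v p \<longleftrightarrow>
     vwalk p (with_proj D) \<and> vwalk_length p = k \<and> hd p = u \<and> last p = v"

definition walk_free :: "nat \<Rightarrow> 'a pair_pre_digraph \<Rightarrow> bool" where
  "walk_free k D \<longleftrightarrow> (\<forall>u \<in> pverts D. \<forall>v \<in> pverts D. \<exists>\<^sub>\<le>\<^sub>1 p. walk_of_length D k u v p)"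

definition free_digraphs :: "nat \<Rightarrow> nat \<Rightarrow> 'a pair_pre_digraph set" where
  "free_digraphs n k = {D. pair_fin_digraph D \<and> card (pverts D) = n \<and> walk_free k D}"

text \<open>
  Every finite digraph is isomorphic to one whose vertices are natural numbers, so the maximum
  may be taken over the latter; the extremal digraphs are allowed over any vertex type.
\<close>

definition ex_number :: "nat \<Rightarrow> nat \<Rightarrow> nat" where
  "ex_number n k = Max ((\<lambda>D :: nat pair_pre_digraph. card (parcs D)) ` free_digraphs n k)"

definition Ex_set :: "nat \<Rightarrow> nat \<Rightarrow> 'a pair_pre_digraph set" where
  "Ex_set n k = {D \<in> free_digraphs n k. card (parcs D) = ex_number n k}"

definition adjacency_mat :: "'a pair_pre_digraph \<Rightarrow> 'a list \<Rightarrow> int mat" where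
  "adjacency_mat D vs =
     mat (length vs) (length vs) (\<lambda>(i, j). if (vs ! i, vs ! j) \<in> parcs D then 1 else 0)"

definition permutation_mat :: "nat \<Rightarrow> (nat \<Rightarrow> nat) \<Rightarrow> int mat" where
  "permutation_mat n \<pi> = mat n n (\<lambda>(i, j). if j = \<pi> i then 1 else 0)"

definition permutation_similar :: "int mat \<Rightarrow> int mat \<Rightarrow> bool" where
  "permutation_similar A B \<longleftrightarrow>
     (\<exists>n \<pi>. A \<in> carrier_mat n n \<and> B \<in> carrier_mat n n \<and> \<pi> permutes {..<n} \<and>
        B = permutation_mat n \<pi> * A * transpose_mat (permutation_mat n \<pi>))"

definition T_mat :: "nat \<Rightarrow> int mat" where
  "T_mat m = mat m m (\<lambda>(i, j). if i < j then 1 else 0)"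

definition J_mat :: "nat \<Rightarrow> nat \<Rightarrow> int mat" where
  "J_mat a b = mat a b (\<lambda>_. 1)"

text \<open>
  The two all-ones blocks of the first block row are merged into a single
  \<open>2 \<times> (n - 2)\<close> block, and likewise the zero blocks below the first diagonal block.
\<close>

definition F_mat :: "nat \<Rightarrow> int mat" where
  "F_mat n = four_block_mat
     (0\<^sub>m 2 2)       (J_mat 2 (n - 2))
     (0\<^sub>m (n - 2) 2) (four_block_mat
                         (T_mat (n - 4))   (J_mat (n - 4) 2)
                         (0\<^sub>m 2 (n - 4)) (0\<^sub>m 2 2))"

end

(*
  A loop or a 2-cycle forces two distinct short walks with the same ends as soon as too many pairs
  around it are adjacent, and such walks can be prolonged along the cycle to any length. Counting
  ordered pairs shows that the s vertices on loops and 2-cycles, which carry almost no arcs among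
  them, leave at most 4 + 3s - s^2 further ordered nonadjacent pairs, so for s > 0 two outside
  vertices (three if s = 1) are adjacent to each other and to all of these s vertices, which is
  impossible. The same argument rules out triangles and chordless 4-cycles, and a longer shortest
  cycle has too many nonadjacent pairs; hence the digraph is acyclic.

  In a topological order at most two pairs i < j are not arcs. Leaving out two vertices gives a
  candidate walk of length n - 3; two candidates with the same ends survive unless the missing
  pairs are the first two and the last two vertices, and this is the pattern of F_n. Conversely,
  for F_n merge the first two and the last two vertices into common levels: every arc goes up,
  so a walk of length n - 3 visits each of the n - 2 levels once.
*)
theory Submission
  imports Defs
begin

section \<open>Colliding walks\<close>

abbreviation walk :: "'a rel \<Rightarrow> 'a list \<Rightarrow> bool" where
  "walk E \<equiv> successively (\<lambda>x y. (x, y) \<in> E)"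

text \<open>The property of being F_k-free for a bare arc relation; reversing all arcs then stays
  within the same locale.\<close>

locale unique_walks =
  fixes E :: "'a rel" and k :: nat
  assumes unique: "\<lbrakk>walk E p; walk E q; length p = Suc k; length q = Suc k; hd p = hd q; last p = last q\<rbrakk>
    \<Longrightarrow> p = q"

lemma unique_walks_converse:
  assumes "unique_walks E k"
  shows "unique_walks (E\<inverse>) k"
proof
  fix p q :: "'a list"
  assume "walk (E\<inverse>) p" "walk (E\<inverse>) q" "length p = Suc k" "length q = Suc k"
    "hd p = hd q" "last p = last q"
  then have "rev p = rev q"
    by (intro unique_walks.unique[OF assms]) (auto simp: hd_rev last_rev)
  then show "p = q" by simp
qed

text \<open>Used to prolong short walks: once inside a set without dead ends, such as a cycle, a
  walk can go on to any prescribed length.\<close>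

lemma walk_within:
  assumes "\<And>c. c \<in> C \<Longrightarrow> \<exists>d\<in>C. (c, d) \<in> E" "x \<in> C"
  shows "\<exists>r. length r = m \<and> walk E (x # r) \<and> set r \<subseteq> C"
  using assms(2)
proof (induction m arbitrary: x)
  case (Suc m)
  from assms(1)[OF Suc.prems] obtain d where d: "d \<in> C" "(x, d) \<in> E" by blast
  from Suc.IH[OF d(1)] obtain r where "length r = m" "walk E (d # r)" "set r \<subseteq> C" by blast
  with d show ?case by (intro exI[of _ "d # r"]) auto
qed auto

context unique_walks
begin

text \<open>Append one common continuation inside \<open>C\<close> to both walks; they then have
  exactly \<open>k\<close> arcs and still the same ends.\<close>

lemma collide_forward:
  assumes C: "\<And>c. c \<in> C \<Longrightarrow> \<exists>d\<in>C. (c, d) \<in> E"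
    and p: "walk E p" "walk E q" "length p = length q" "hd p = hd q" "last p = last q"
    and "p \<noteq> []" "length p \<le> Suc k" "last p \<in> C"
  shows "p = q"
proof -
  obtain r where r: "length r = Suc k - length p" "walk E (last p # r)"
    using walk_within[of C E, OF C \<open>last p \<in> C\<close>] by blast
  have "q \<noteq> []" using p(3) \<open>p \<noteq> []\<close> by auto
  have "p @ r = q @ r"
    using r p \<open>p \<noteq> []\<close> \<open>q \<noteq> []\<close> \<open>length p \<le> Suc k\<close>
    by (intro unique) (auto simp: successively_append_iff successively_Cons last_append)
  then show ?thesis by simp
qed

text \<open>The mirror image of \<open>collide_forward\<close>, for walks that start in
  \<open>C\<close>; all arcs are reversed.\<close>

lemma collide_backward:
  assumes C: "\<And>c. c \<in> C \<Longrightarrow> \<exists>d\<in>C. (d, c) \<in> E"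
    and p: "walk E p" "walk E q" "length p = length q" "hd p = hd q" "last p = last q"
    and "p \<noteq> []" "length p \<le> Suc k" "hd p \<in> C"
  shows "p = q"
proof -
  interpret conv: unique_walks "E\<inverse>" k
    by (rule unique_walks_converse) unfold_locales
  have "rev p = rev q"
    by (rule conv.collide_forward[of C]) (use assms in \<open>auto simp: last_rev hd_rev\<close>)
  then show ?thesis by simp
qed

lemma sandwich:
  assumes C: "\<And>c. c \<in> C \<Longrightarrow> \<exists>d\<in>C. (c, d) \<in> E"
    and "x \<in> C" "y \<in> C" "(u, x) \<in> E" "(u, y) \<in> E" "\<And>c. c \<in> C \<Longrightarrow> (c, v) \<in> E" "k \<ge> 2"
  shows "x = y"
proof -
  \<comment> \<open>Entering and leaving \<open>C\<close> take two arcs, so \<open>k - 2\<close> are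
    spent inside.\<close>
  obtain r where r: "length r = k - 2" "walk E (x # r)" "set r \<subseteq> C"
    using walk_within[of C E, OF C \<open>x \<in> C\<close>] by blast
  obtain s where s: "length s = k - 2" "walk E (y # s)" "set s \<subseteq> C"
    using walk_within[of C E, OF C \<open>y \<in> C\<close>] by blast
  have "last (x # r) \<in> C" "last (y # s) \<in> C" using r s assms(2,3) last_in_set
    by (metis insert_subset list.distinct(1) list.set(2) subsetD)+
  then have "walk E ((u # x # r) @ [v])" "walk E ((u # y # s) @ [v])"
    using r s assms by (simp_all add: successively_append_iff del: append_Cons)
  then have "(u # x # r) @ [v] = (u # y # s) @ [v]"
    using r s \<open>k \<ge> 2\<close> by (intro unique) simp_all
  then show ?thesis by simp
qed

end

text \<open>Four arcs is the length of the longest short walks that are prolonged below, those in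
  \<open>reciprocal_uniform\<close>.\<close>

locale unique_long_walks = unique_walks +
  assumes k_ge: "k \<ge> 4"
begin

text \<open>Two closed walks of length 2 at \<open>x\<close> collide. The case \<open>y = x\<close>
  says that a vertex with a loop lies on no 2-cycle.\<close>

lemma partner_unique:
  assumes "(x, y) \<in> E" "(y, x) \<in> E" "(x, z) \<in> E" "(z, x) \<in> E"
  shows "y = z"
proof -
  have "[x, y, x] = [x, z, x]"
    by (rule collide_forward[of "{x, y}"]) (use assms k_ge in auto)
  then show ?thesis by simp
qed

text \<open>From \<open>v\<close> to \<open>x\<close> one can circle the 2-cycle or loop of
  \<open>v\<close> before the arc, or that of \<open>x\<close> after it.\<close>

lemma reciprocal_apart:
  assumes "(x, y) \<in> E" "(y, x) \<in> E" "(v, w) \<in> E" "(w, v) \<in> E" "(v, x) \<in> E"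
  shows "w = x"
proof -
  have "[v, w, v, x] = [v, x, y, x]"
    by (rule collide_forward[of "{x, y}"]) (use assms k_ge in auto)
  then show ?thesis by simp
qed

text \<open>The 2-cycle through \<open>x\<close> and \<open>y\<close> could be traversed before or
  after the path \<open>y\<close>, \<open>v\<close>, \<open>x\<close>. Applied in both directions: a
  vertex adjacent to \<open>x\<close> and \<open>y\<close> sends arcs to both or receives arcs from
  both.\<close>

lemma reciprocal_uniform:
  assumes "(x, y) \<in> E" "(y, x) \<in> E" "v \<noteq> x" "v \<noteq> y"
  shows "\<not> ((v, x) \<in> E \<and> (y, v) \<in> E)"
proof
  assume *: "(v, x) \<in> E \<and> (y, v) \<in> E"
  show False
  proof (cases "x = y")
    case True
    then have "[x, x, x] = [x, v, x]"
      by (intro collide_forward[of "{x, y}"]) (use assms k_ge * in auto)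
    then show ?thesis using assms by simp
  next
    case False
    have "[y, x, y, v, x] = [y, v, x, y, x]"
      by (rule collide_forward[of "{x, y}"]) (use assms k_ge * in auto)
    then show ?thesis using assms by simp
  qed
qed

text \<open>In each of the other three orientations a detour through \<open>u\<close> or
  \<open>v\<close> collides with a walk through \<open>C\<close>; so \<open>C\<close> lies between
  \<open>u\<close> and \<open>v\<close>.\<close>

lemma orient:
  assumes S: "\<And>c. c \<in> C \<Longrightarrow> \<exists>d\<in>C. (c, d) \<in> E" and P: "\<And>c. c \<in> C \<Longrightarrow> \<exists>d\<in>C. (d, c) \<in> E"
    and "x \<in> C" "u \<notin> C" "v \<notin> C" "(u, v) \<in> E"
    and u: "(\<forall>c\<in>C. (u, c) \<in> E) \<or> (\<forall>c\<in>C. (c, u) \<in> E)"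
    and v: "(\<forall>c\<in>C. (v, c) \<in> E) \<or> (\<forall>c\<in>C. (c, v) \<in> E)"
  shows "(\<forall>c\<in>C. (u, c) \<in> E) \<and> (\<forall>c\<in>C. (c, v) \<in> E)"
proof -
  obtain y where y: "y \<in> C" "(y, x) \<in> E" using P \<open>x \<in> C\<close> by blast
  obtain z where z: "z \<in> C" "(x, z) \<in> E" using S \<open>x \<in> C\<close> by blast
  obtain z' where z': "z' \<in> C" "(z, z') \<in> E" using S z by blast
  obtain z'' where z'': "z'' \<in> C" "(z', z'') \<in> E" using S z' by blast
  have "\<not> (\<forall>c\<in>C. (v, c) \<in> E)"
  proof
    assume out: "\<forall>c\<in>C. (v, c) \<in> E"
    from u show False
    proof
      assume "\<forall>c\<in>C. (u, c) \<in> E"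
      then have "[u, v, x] = [u, y, x]"
        by (intro collide_forward[of C]) (use assms(1,3,6) y out k_ge in auto)
      then show False using y \<open>v \<notin> C\<close> by simp
    next
      assume "\<forall>c\<in>C. (c, u) \<in> E"
      then have "[x, u, v, z''] = [x, z, z', z'']"
        by (intro collide_forward[of C]) (use assms(1,3,6) z z' z'' out k_ge in auto)
      then show False using z \<open>u \<notin> C\<close> by simp
    qed
  qed
  with v have v': "\<forall>c\<in>C. (c, v) \<in> E" by blast
  have "\<not> (\<forall>c\<in>C. (c, u) \<in> E)"
  proof
    assume into: "\<forall>c\<in>C. (c, u) \<in> E"
    \<comment> \<open>\<open>v\<close> lies outside \<open>C\<close>, so this pair of walks is
      prolonged before its start \<open>x\<close>.\<close>
    have "[x, u, v] = [x, z, v]"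
      by (rule collide_backward[of C]) (use P assms(3,6) z into v' k_ge in auto)
    then show False using z \<open>u \<notin> C\<close> by simp
  qed
  with u v' show ?thesis by blast
qed

text \<open>\<open>orient\<close> puts all of \<open>C\<close> between the two vertices, and
  \<open>sandwich\<close> then forbids two different entry points.\<close>

lemma no_two_joined:
  assumes "\<And>c. c \<in> C \<Longrightarrow> \<exists>d\<in>C. (c, d) \<in> E" "\<And>c. c \<in> C \<Longrightarrow> \<exists>d\<in>C. (d, c) \<in> E"
    and "x \<in> C" "y \<in> C" "x \<noteq> y" "u \<notin> C" "v \<notin> C" "(u, v) \<in> E \<or> (v, u) \<in> E"
    and "(\<forall>c\<in>C. (u, c) \<in> E) \<or> (\<forall>c\<in>C. (c, u) \<in> E)"
    and "(\<forall>c\<in>C. (v, c) \<in> E) \<or> (\<forall>c\<in>C. (c, v) \<in> E)"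
  shows False
  using assms(8)
proof
  assume "(u, v) \<in> E"
  then have "(\<forall>c\<in>C. (u, c) \<in> E) \<and> (\<forall>c\<in>C. (c, v) \<in> E)"
    by (intro orient[of C x]) (use assms in auto)
  then show False using sandwich[of C x y u v] assms k_ge by auto
next
  assume "(v, u) \<in> E"
  then have "(\<forall>c\<in>C. (v, c) \<in> E) \<and> (\<forall>c\<in>C. (c, u) \<in> E)"
    by (intro orient[of C x]) (use assms in auto)
  then show False using sandwich[of C x y v u] assms k_ge by auto
qed

end

section \<open>Loops and 2-cycles\<close>

text \<open>One element of each unordered pair of \<open>Q\<close> meeting \<open>X\<close> is thrown away.\<close>

lemma independent_remainder:
  fixes Q :: "'a rel"
  assumes "finite Q" "sym Q" "irrefl Q" "card Q \<le> 2 * r" "finite X" "r + t \<le> card X"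
  shows "\<exists>T\<subseteq>X. t \<le> card T \<and> (\<forall>(a, b)\<in>Q. a \<in> T \<longrightarrow> b \<in> X - T)"
  using assms
proof (induction r arbitrary: Q X)
  case 0
  then show ?case by (intro exI[of _ X]) auto
next
  case (Suc r)
  show ?case
  proof (cases "\<exists>(a, b)\<in>Q. a \<in> X")
    case False
    with Suc.prems show ?thesis by (intro exI[of _ X]) auto
  next
    case True
    then obtain a b where ab: "(a, b) \<in> Q" "a \<in> X" by auto
    with Suc.prems(2,3) have ba: "(b, a) \<in> Q" "a \<noteq> b" by (auto simp: sym_def irrefl_def)
    \<comment> \<open>\<open>Q\<close> is symmetric, so discarding \<open>a\<close> settles two
      ordered pairs at once; hence the factor 2 in the bound on \<open>card Q\<close>.\<close>
    let ?Q = "Q - {(a, b), (b, a)}"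
    have "card ?Q = card Q - 2"
      using Suc.prems(1) ab ba by (subst card_Diff_subset) auto
    then have "\<exists>T\<subseteq>X - {a}. t \<le> card T \<and> (\<forall>(c, d)\<in>?Q. c \<in> T \<longrightarrow> d \<in> (X - {a}) - T)"
      using Suc.prems ab by (intro Suc.IH) (auto simp: sym_def irrefl_def)
    then obtain T where "T \<subseteq> X - {a}" "t \<le> card T"
      "\<forall>(c, d)\<in>?Q. c \<in> T \<longrightarrow> d \<in> (X - {a}) - T" by blast
    with ab ba show ?thesis by (intro exI[of _ T]) auto
  qed
qed

lemma two_elements:
  assumes "2 \<le> card T"
  obtains u v where "u \<in> T" "v \<in> T" "u \<noteq> v"
proof -
  from assms have "\<not> card T \<le> 1" by simp
  then show thesis using that by (metis card_le_Suc0_iff_eq card.infinite le0 One_nat_def)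
qed

lemma third_element:
  assumes "3 \<le> card T"
  obtains w where "w \<in> T" "w \<noteq> u" "w \<noteq> v"
proof -
  have "card {u, v} < card T" using assms card_insert_le_m1[of 2 "{v}" u] by (simp add: card_insert_if)
  then have "\<not> T \<subseteq> {u, v}" by (meson card_mono finite.emptyI finite.insertI leD)
  then show thesis using that by blast
qed

text \<open>Here \<open>k + 3\<close> is the order n, and \<open>dense\<close> asks for at least
  n(n-1)/2 - 2 arcs, written without division or subtraction.\<close>

locale dense_unique_walks = unique_long_walks +
  fixes V :: "'a set"
  assumes finite_V: "finite V" and E_subset: "E \<subseteq> V \<times> V"
    and card_V: "card V = k + 3"
    and dense: "card V * card V \<le> 2 * card E + card V + 4"
begin

section \<open>Counting ordered nonadjacent pairs\<close>

definition nonadjacent :: "'a rel" where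
  "nonadjacent = {(a, b) \<in> V \<times> V. a \<noteq> b \<and> (a, b) \<notin> E \<and> (b, a) \<notin> E}"

text \<open>\<open>y = x\<close> is allowed, so vertices with loops are included.\<close>

definition reciprocal :: "'a set" where
  "reciprocal = {x. \<exists>y. (x, y) \<in> E \<and> (y, x) \<in> E}"

lemma finite_E: "finite E"
  using finite_V E_subset finite_subset by blast

lemma reciprocal_subset: "reciprocal \<subseteq> V"
  using E_subset by (auto simp: reciprocal_def)

lemma finite_reciprocal: "finite reciprocal"
  using reciprocal_subset finite_V finite_subset by blast

lemma finite_nonadjacent: "finite nonadjacent"
  using finite_V by (rule_tac finite_subset[of _ "V \<times> V"]) (auto simp: nonadjacent_def)

lemma sym_nonadjacent: "sym nonadjacent"
  by (auto simp: nonadjacent_def sym_def)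

text \<open>By \<open>partner_unique\<close> a reciprocal arc is determined by its tail.\<close>

lemma card_reciprocal: "card (E \<inter> E\<inverse>) = card reciprocal"
proof -
  have "inj_on fst (E \<inter> E\<inverse>)" using partner_unique by (fastforce intro: inj_onI)
  moreover have "fst ` (E \<inter> E\<inverse>) = reciprocal" by (force simp: reciprocal_def)
  ultimately show ?thesis by (metis card_image)
qed

text \<open>\<open>reciprocal_apart\<close> makes \<open>x\<close> the partner of
  \<open>v\<close>.\<close>

lemma reciprocal_inside:
  assumes "v \<in> reciprocal" "x \<in> reciprocal" "(v, x) \<in> E"
  shows "(x, v) \<in> E"
  using assms reciprocal_apart unfolding reciprocal_def by blast

text \<open>Split \<open>V \<times> V\<close> into the nonadjacent pairs, the diagonal without
  loops, and \<open>E \<union> E\<inverse>\<close>; the last part has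
  \<open>2 * card E - card reciprocal\<close> elements by inclusion-exclusion.\<close>

lemma card_nonadjacent:
  "card nonadjacent + card V + 2 * card E = card V * card V + card {x. (x, x) \<in> E} + card reciprocal"
proof -
  let ?L = "{x. (x, x) \<in> E}"
  have L: "?L \<subseteq> V" using E_subset by auto
  have "card (E \<union> E\<inverse>) + card reciprocal = card E + card (E\<inverse>)"
    using card_Un_Int[of E "E\<inverse>"] finite_E card_reciprocal by simp
  moreover have "card (E\<inverse>) = card E" by (rule card_inverse)
  moreover have "card (V \<times> V) = card nonadjacent + card (Id_on (V - ?L)) + card (E \<union> E\<inverse>)"
  proof -
    have "V \<times> V = nonadjacent \<union> Id_on (V - ?L) \<union> (E \<union> E\<inverse>)"
      using E_subset by (auto simp: nonadjacent_def)
    moreover have "(nonadjacent \<union> Id_on (V - ?L)) \<inter> (E \<union> E\<inverse>) = {}" "nonadjacent \<inter> Id_on (V - ?L) = {}"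
      by (auto simp: nonadjacent_def)
    moreover have "finite (Id_on (V - ?L))"
      using finite_V by (rule_tac finite_subset[of _ "V \<times> V"]) auto
    ultimately show ?thesis
      using finite_nonadjacent finite_E by (simp add: card_Un_disjoint)
  qed
  moreover have "card (Id_on (V - ?L)) + card ?L = card V"
  proof -
    have "Id_on (V - ?L) = (\<lambda>x. (x, x)) ` (V - ?L)" by auto
    then have "card (Id_on (V - ?L)) = card (V - ?L)" by (simp add: card_image inj_on_def)
    then show ?thesis using L finite_V card_mono[OF finite_V L]
      by (simp add: card_Diff_subset finite_subset)
  qed
  ultimately show ?thesis by (simp add: card_cartesian_product)
qed

text \<open>The same splitting of \<open>reciprocal \<times> reciprocal\<close>, where by
  \<open>reciprocal_inside\<close> all arcs lie in \<open>E \<inter> E\<inverse>\<close>.\<close>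

lemma card_nonadjacent_reciprocal:
  "card (nonadjacent \<inter> reciprocal \<times> reciprocal) + 2 * card reciprocal = card reciprocal * card reciprocal + card {x. (x, x) \<in> E}"
proof -
  let ?L = "{x. (x, x) \<in> E}"
  have L: "?L \<subseteq> reciprocal" by (auto simp: reciprocal_def)
  have "card (reciprocal \<times> reciprocal) = card (nonadjacent \<inter> reciprocal \<times> reciprocal) + card (Id_on (reciprocal - ?L)) + card (E \<inter> E\<inverse>)"
  proof -
    have "reciprocal \<times> reciprocal = nonadjacent \<inter> reciprocal \<times> reciprocal \<union> Id_on (reciprocal - ?L) \<union> (E \<inter> E\<inverse>)"
    proof (intro equalityI subsetI)
      fix e assume e: "e \<in> reciprocal \<times> reciprocal"
      obtain a b where ab: "e = (a, b)" by fastforce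
      show "e \<in> nonadjacent \<inter> reciprocal \<times> reciprocal \<union> Id_on (reciprocal - ?L) \<union> (E \<inter> E\<inverse>)"
        using e ab reciprocal_subset reciprocal_inside[of a b] reciprocal_inside[of b a]
        by (cases "a = b") (auto simp: nonadjacent_def)
    next
      fix e assume "e \<in> nonadjacent \<inter> reciprocal \<times> reciprocal \<union> Id_on (reciprocal - ?L) \<union> (E \<inter> E\<inverse>)"
      then show "e \<in> reciprocal \<times> reciprocal" by (auto simp: reciprocal_def)
    qed
    moreover have "(nonadjacent \<inter> reciprocal \<times> reciprocal \<union> Id_on (reciprocal - ?L)) \<inter> (E \<inter> E\<inverse>) = {}"
      "nonadjacent \<inter> reciprocal \<times> reciprocal \<inter> Id_on (reciprocal - ?L) = {}"
      by (auto simp: nonadjacent_def)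
    moreover have "finite (Id_on (reciprocal - ?L))"
      using finite_reciprocal by (rule_tac finite_subset[of _ "reciprocal \<times> reciprocal"]) auto
    ultimately show ?thesis
      using finite_nonadjacent finite_E by (metis (no_types, lifting) card_Un_disjoint finite_Int finite_Un)
  qed
  moreover have "card (Id_on (reciprocal - ?L)) + card ?L = card reciprocal"
  proof -
    have "Id_on (reciprocal - ?L) = (\<lambda>x. (x, x)) ` (reciprocal - ?L)" by auto
    then have "card (Id_on (reciprocal - ?L)) = card (reciprocal - ?L)" by (simp add: card_image inj_on_def)
    then show ?thesis using L finite_reciprocal card_mono[OF finite_reciprocal L]
      by (simp add: card_Diff_subset finite_subset)
  qed
  ultimately show ?thesis using card_reciprocal by (simp add: card_cartesian_product)
qed

text \<open>On subtracting the two counts the number of loops cancels.\<close>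

lemma card_nonadjacent_outside:
  "card (nonadjacent - reciprocal \<times> reciprocal) + card reciprocal * card reciprocal \<le> 4 + 3 * card reciprocal"
proof -
  have "card (nonadjacent - reciprocal \<times> reciprocal) + card (nonadjacent \<inter> reciprocal \<times> reciprocal) = card nonadjacent"
    using finite_nonadjacent card_Int_Diff[of nonadjacent "reciprocal \<times> reciprocal"] by simp
  then show ?thesis using card_nonadjacent card_nonadjacent_reciprocal dense by linarith
qed

text \<open>\<open>x\<close> and its partner form the set \<open>C\<close> of \<open>orient\<close>;
  \<open>reciprocal_uniform\<close> supplies the uniform orientation towards it.\<close>

lemma joined_through_reciprocal:
  assumes "(u, v) \<in> E" "u \<notin> reciprocal" "v \<notin> reciprocal" "x \<in> reciprocal"
    and "\<And>c. c \<in> reciprocal \<Longrightarrow> (u, c) \<in> E \<or> (c, u) \<in> E"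
    and "\<And>c. c \<in> reciprocal \<Longrightarrow> (v, c) \<in> E \<or> (c, v) \<in> E"
  shows "(u, x) \<in> E \<and> (x, v) \<in> E"
proof -
  obtain y where y: "(x, y) \<in> E" "(y, x) \<in> E" using \<open>x \<in> reciprocal\<close> by (auto simp: reciprocal_def)
  then have "y \<in> reciprocal" by (auto simp: reciprocal_def)
  have uniform: "(\<forall>c\<in>{x, y}. (w, c) \<in> E) \<or> (\<forall>c\<in>{x, y}. (c, w) \<in> E)"
    if "w \<notin> reciprocal" "\<And>c. c \<in> reciprocal \<Longrightarrow> (w, c) \<in> E \<or> (c, w) \<in> E" for w
    using reciprocal_uniform[of x y w] reciprocal_uniform[of y x w] y that \<open>x \<in> reciprocal\<close> \<open>y \<in> reciprocal\<close> by blast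
  have "(\<forall>c\<in>{x, y}. (u, c) \<in> E) \<and> (\<forall>c\<in>{x, y}. (c, v) \<in> E)"
    by (rule orient[of "{x, y}" x, OF _ _ _ _ _ _ uniform uniform])
      (use assms y \<open>y \<in> reciprocal\<close> in auto)
  then show ?thesis by blast
qed

lemma reciprocal_empty: "reciprocal = {}"
proof (rule ccontr)
  assume "reciprocal \<noteq> {}"
  let ?s = "card reciprocal" and ?Q = "nonadjacent - reciprocal \<times> reciprocal"
  have "?s > 0" using \<open>reciprocal \<noteq> {}\<close> finite_reciprocal by (simp add: card_gt_0_iff)
  have Q: "card ?Q + ?s * ?s \<le> 4 + 3 * ?s" by (rule card_nonadjacent_outside)
  have "?s \<le> 4"
  proof (rule ccontr)
    assume "\<not> ?s \<le> 4"
    then have "5 * ?s \<le> ?s * ?s" by (intro mult_right_mono) auto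
    then show False using Q \<open>\<not> ?s \<le> 4\<close> by linarith
  qed
  with \<open>?s > 0\<close> consider "?s = 1" | "?s = 2" | "?s = 3" | "?s = 4" by linarith
  \<comment> \<open>\<open>r\<close> is half of the bound 6, 6, 4, 0 on \<open>card ?Q\<close>, and
    \<open>t\<close> is what remains of at least \<open>7 - ?s\<close> outside vertices after
    \<open>r\<close> of them are dropped.\<close>
  then obtain r t where rt: "card ?Q \<le> 2 * r" "r + t + ?s \<le> 7" "t \<ge> 2" "?s = 1 \<Longrightarrow> t = 3"
  proof cases
    case 1 with Q show ?thesis by (intro that[of 3 3]) auto
  next
    case 2 with Q show ?thesis by (intro that[of 3 2]) auto
  next
    case 3 with Q show ?thesis by (intro that[of 2 2]) auto
  next
    case 4 with Q show ?thesis by (intro that[of 0 3]) auto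
  qed
  have "card (V - reciprocal) = card V - ?s"
    using reciprocal_subset finite_reciprocal by (simp add: card_Diff_subset)
  then have "r + t \<le> card (V - reciprocal)" using rt card_V k_ge by linarith
  moreover have "sym ?Q" "irrefl ?Q"
    using sym_nonadjacent by (auto simp: sym_def irrefl_def nonadjacent_def)
  ultimately obtain T where T: "T \<subseteq> V - reciprocal" "t \<le> card T"
    "\<forall>(a, b)\<in>?Q. a \<in> T \<longrightarrow> b \<in> V - reciprocal - T"
    using independent_remainder[of ?Q r "V - reciprocal" t] finite_nonadjacent finite_V rt(1) by auto
  have adj: "(a, b) \<in> E \<or> (b, a) \<in> E" if "a \<in> T" "b \<in> T \<union> reciprocal" "a \<noteq> b" for a b
    using T(1,3) that reciprocal_subset by (auto simp: nonadjacent_def)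
  have through: "(u, x) \<in> E \<and> (x, v) \<in> E" if "(u, v) \<in> E" "u \<in> T" "v \<in> T" "x \<in> reciprocal" for u v x
    using joined_through_reciprocal[of u v x] adj that T(1) by blast
  have apart: "\<not> ((u, x) \<in> E \<and> (x, u) \<in> E)" if "u \<in> T" for u x
    using that T(1) by (auto simp: reciprocal_def)
  show False
  proof (cases "?s = 1")
    case True
    then obtain x where x: "reciprocal = {x}" by (auto simp: card_1_singleton_iff)
    have "t = 3" using rt True by blast
    then obtain u v where "u \<in> T" "v \<in> T" "u \<noteq> v" using T(2) two_elements[of T] by auto
    then obtain u v where uv: "u \<in> T" "v \<in> T" "(u, v) \<in> E" using adj by blast
    obtain w where w: "w \<in> T" "w \<noteq> u" "w \<noteq> v" using \<open>t = 3\<close> T(2) third_element[of T] by auto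
    \<comment> \<open>By \<open>through\<close>, every arc inside \<open>T\<close> runs from an
      in-neighbour of \<open>x\<close> to an out-neighbour, and by \<open>apart\<close> no vertex is
      both; so no three vertices of \<open>T\<close> are pairwise adjacent.\<close>
    show False using through[of _ _ x] apart adj[of u w] adj[of v w] uv w x by blast
  next
    case False
    then have "2 \<le> ?s" using \<open>?s > 0\<close> by linarith
    then obtain x y where xy: "x \<in> reciprocal" "y \<in> reciprocal" "x \<noteq> y" by (rule two_elements)
    obtain u v where "u \<in> T" "v \<in> T" "u \<noteq> v" using T(2) rt(3) two_elements[of T] by auto
    then obtain u v where uv: "u \<in> T" "v \<in> T" "(u, v) \<in> E" using adj by blast
    have "x = y"
    proof (rule sandwich[of reciprocal x y u v])
      show "\<exists>d\<in>reciprocal. (c, d) \<in> E" if "c \<in> reciprocal" for c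
        using that unfolding reciprocal_def by blast
      show "(u, x) \<in> E" "(u, y) \<in> E" using through uv xy by blast+
      show "(c, v) \<in> E" if "c \<in> reciprocal" for c using through uv that by blast
      show "k \<ge> 2" using k_ge by simp
    qed (use xy in auto)
    with xy show False by simp
  qed
qed

lemma antisymmetric: "(x, y) \<in> E \<Longrightarrow> (y, x) \<notin> E"
  using reciprocal_empty by (auto simp: reciprocal_def)

lemma card_nonadjacent_le: "card nonadjacent \<le> 4"
  using card_nonadjacent_outside reciprocal_empty by simp
end

section \<open>Longer cycles\<close>

context dense_unique_walks
begin

text \<open>With at most four ordered nonadjacent pairs, two outside vertices are adjacent to each
  other and to the whole triangle, which \<open>no_two_joined\<close> excludes.\<close>

lemma no_triangle:
  assumes xyz: "(x, y) \<in> E" "(y, z) \<in> E" "(z, x) \<in> E"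
  shows False
proof -
  let ?C = "{x, y, z}"
  have ne: "x \<noteq> y" "y \<noteq> z" "x \<noteq> z" using xyz antisymmetric by blast+
  have "?C \<subseteq> V" using xyz E_subset by auto
  have S: "\<exists>d\<in>?C. (c, d) \<in> E" if "c \<in> ?C" for c using that xyz by auto
  have P: "\<exists>d\<in>?C. (d, c) \<in> E" if "c \<in> ?C" for c using that xyz by auto
  have "card (V - ?C) = card V - 3"
    using \<open>?C \<subseteq> V\<close> ne by (simp add: card_Diff_subset)
  \<comment> \<open>At least \<open>7 - 3\<close> vertices lie outside; two may be discarded and two
    are kept.\<close>
  then have "2 + 2 \<le> card (V - ?C)" using card_V k_ge by simp
  moreover have "irrefl nonadjacent" by (auto simp: irrefl_def nonadjacent_def)
  ultimately obtain T where T: "T \<subseteq> V - ?C" "2 \<le> card T"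
    "\<forall>(a, b)\<in>nonadjacent. a \<in> T \<longrightarrow> b \<in> V - ?C - T"
    using independent_remainder[of nonadjacent 2 "V - ?C" 2] finite_nonadjacent sym_nonadjacent
      card_nonadjacent_le finite_V by auto
  have adj: "(a, b) \<in> E \<or> (b, a) \<in> E" if "a \<in> T" "b \<in> T \<union> ?C" "a \<noteq> b" for a b
    using T(1,3) that \<open>?C \<subseteq> V\<close> by (auto simp: nonadjacent_def)
  \<comment> \<open>An arc from \<open>u\<close> to \<open>c\<close> would make \<open>a\<close>,
    \<open>u\<close>, \<open>c\<close> collide with \<open>a\<close>, \<open>b\<close>,
    \<open>c\<close>. Double steps run through the whole triangle, so one arc into \<open>u\<close>
    yields all three.\<close>
  have step: "(c, u) \<in> E"
    if "(a, b) \<in> E" "(b, c) \<in> E" "c \<in> ?C" "b \<in> ?C" "(a, u) \<in> E" "u \<in> T" for a b c u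
  proof (rule ccontr)
    assume "(c, u) \<notin> E"
    then have "(u, c) \<in> E" using adj[of u c] that T(1) by auto
    have "[a, b, c] = [a, u, c]"
      by (rule collide_forward[OF S]) (use that \<open>(u, c) \<in> E\<close> k_ge in auto)
    then show False using that T(1) by auto
  qed
  have uniform: "(\<forall>c\<in>?C. (u, c) \<in> E) \<or> (\<forall>c\<in>?C. (c, u) \<in> E)" if "u \<in> T" for u
  proof (cases "\<exists>c\<in>?C. (c, u) \<in> E")
    case True
    moreover have "(z, u) \<in> E" if "(x, u) \<in> E"
      using step[OF xyz(1,2) _ _ that \<open>u \<in> T\<close>] by simp
    moreover have "(x, u) \<in> E" if "(y, u) \<in> E"
      using step[OF xyz(2,3) _ _ that \<open>u \<in> T\<close>] by simp
    moreover have "(y, u) \<in> E" if "(z, u) \<in> E"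
      using step[OF xyz(3,1) _ _ that \<open>u \<in> T\<close>] by simp
    ultimately show ?thesis by blast
  next
    case False
    then show ?thesis using adj[OF that] that T(1) by blast
  qed
  obtain u v where uv: "u \<in> T" "v \<in> T" "u \<noteq> v" using T(2) two_elements by auto
  show False
    by (rule no_two_joined[of ?C x y u v, OF S P _ _ _ _ _ _ uniform uniform])
      (use uv adj T(1) ne in auto)
qed

text \<open>The two diagonals use up all four ordered nonadjacent pairs, so every outside vertex is
  adjacent to the whole square, and \<open>no_triangle\<close> makes its arcs there point the same
  way.\<close>

lemma no_chordless_square:
  assumes E: "(a, b) \<in> E" "(b, c) \<in> E" "(c, d) \<in> E" "(d, a) \<in> E"
    and N: "(a, c) \<in> nonadjacent" "(b, d) \<in> nonadjacent"
  shows False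
proof -
  let ?C = "{a, b, c, d}" and ?N = "{(a, c), (c, a), (b, d), (d, b)}"
  have ne: "a \<noteq> b" "b \<noteq> c" "c \<noteq> d" "d \<noteq> a" "a \<noteq> c" "b \<noteq> d"
    using E N antisymmetric by (auto simp: nonadjacent_def)
  have "?C \<subseteq> V" using E E_subset by auto
  have S: "\<exists>f\<in>?C. (e, f) \<in> E" if "e \<in> ?C" for e using that E by auto
  have P: "\<exists>f\<in>?C. (f, e) \<in> E" if "e \<in> ?C" for e using that E by auto
  have "?N \<subseteq> nonadjacent" using N sym_nonadjacent by (auto simp: sym_def)
  moreover have "card ?N = 4" using ne by auto
  ultimately have "nonadjacent = ?N"
    using card_nonadjacent_le finite_nonadjacent by (metis card_seteq)
  then have adj: "(u, e) \<in> E \<or> (e, u) \<in> E" if "u \<in> V - ?C" "e \<in> V" "u \<noteq> e" for u e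
    using that by (auto simp: nonadjacent_def)
  \<comment> \<open>Otherwise \<open>u\<close>, \<open>e\<close>, \<open>f\<close> would form a
    triangle; an arc from \<open>u\<close> thus propagates around the square.\<close>
  have step: "(u, f) \<in> E" if "(e, f) \<in> E" "f \<in> ?C" "(u, e) \<in> E" "u \<in> V - ?C" for e f u
    using adj[of u f] that \<open>?C \<subseteq> V\<close> no_triangle[of u e f] by auto
  have uniform: "(\<forall>e\<in>?C. (u, e) \<in> E) \<or> (\<forall>e\<in>?C. (e, u) \<in> E)" if "u \<in> V - ?C" for u
  proof (cases "\<exists>e\<in>?C. (u, e) \<in> E")
    case True
    moreover have "(u, b) \<in> E" if "(u, a) \<in> E"
      using step[OF E(1) _ that \<open>u \<in> V - ?C\<close>] by simp
    moreover have "(u, c) \<in> E" if "(u, b) \<in> E"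
      using step[OF E(2) _ that \<open>u \<in> V - ?C\<close>] by simp
    moreover have "(u, d) \<in> E" if "(u, c) \<in> E"
      using step[OF E(3) _ that \<open>u \<in> V - ?C\<close>] by simp
    moreover have "(u, a) \<in> E" if "(u, d) \<in> E"
      using step[OF E(4) _ that \<open>u \<in> V - ?C\<close>] by simp
    ultimately show ?thesis by blast
  next
    case False
    then show ?thesis using adj[OF that] that \<open>?C \<subseteq> V\<close> by blast
  qed
  have "card (V - ?C) = card V - 4"
    using \<open>?C \<subseteq> V\<close> ne by (simp add: card_Diff_subset)
  then have "2 \<le> card (V - ?C)" using card_V k_ge by simp
  then obtain u v where uv: "u \<in> V - ?C" "v \<in> V - ?C" "u \<noteq> v" by (rule two_elements)
  show False
    by (rule no_two_joined[of ?C a b u v, OF S P _ _ _ _ _ _ uniform uniform])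
      (use uv adj[of u v] ne in auto)
qed

text \<open>On a shortest cycle, vertices two steps apart are nonadjacent: a forward arc would
  shorten the cycle, a backward arc would close a triangle. Length 4 gives a chordless square,
  greater length too many nonadjacent pairs.\<close>

lemma acyclic_E: "acyclic E"
proof (rule ccontr)
  assume "\<not> acyclic E"
  then have ex: "\<exists>m. 0 < m \<and> (\<exists>x. (x, x) \<in> E ^^ m)" by (auto simp: acyclic_def trancl_power)
  define m where "m = (LEAST m. 0 < m \<and> (\<exists>x. (x, x) \<in> E ^^ m))"
  from LeastI_ex[OF ex] obtain x where "0 < m" and x: "(x, x) \<in> E ^^ m" unfolding m_def by blast
  have shorter: "(y, y) \<notin> E ^^ j" if "0 < j" "j < m" for j y
    using not_less_Least[of j "\<lambda>m. 0 < m \<and> (\<exists>x. (x, x) \<in> E ^^ m)"] that unfolding m_def by blast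
  have "m \<noteq> 1" using x antisymmetric[of x x] by auto
  moreover have "m \<noteq> 2" using x antisymmetric by (auto simp: numeral_2_eq_2)
  moreover have "m \<noteq> 3" using x no_triangle by (auto simp: numeral_3_eq_3)
  ultimately have "m = Suc (Suc (Suc (Suc (m - 4))))" using \<open>0 < m\<close> by simp
  then obtain j where m: "m = Suc (Suc (Suc (Suc j)))" ..
  from x[unfolded m] obtain y z w v where E: "(x, y) \<in> E" "(y, z) \<in> E" "(z, w) \<in> E" "(w, v) \<in> E"
    and v: "(v, x) \<in> E ^^ j"
    by (meson relpow_Suc_D2)
  have wx: "(w, x) \<in> E ^^ Suc j" using E(4) v by (rule relpow_Suc_I2)
  have zx: "(z, x) \<in> E ^^ Suc (Suc j)" using E(3) wx by (rule relpow_Suc_I2)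
  have chordless: "(a, c) \<in> nonadjacent"
    if "(a, b) \<in> E" "(b, c) \<in> E" "\<not> (a, c) \<in> E" "a \<noteq> c" for a b c
    using that E_subset no_triangle[of a b c] by (auto simp: nonadjacent_def)
  have "(x, z) \<notin> E"
    using shorter[of "Suc (Suc (Suc j))" x] relpow_Suc_I2[OF _ zx, of x] m by auto
  moreover have "x \<noteq> z" using E antisymmetric by blast
  ultimately have xz: "(x, z) \<in> nonadjacent" using chordless E by blast
  have "(y, w) \<notin> E"
    using shorter[of "Suc (Suc (Suc j))" x] relpow_Suc_I2[OF E(1) relpow_Suc_I2[OF _ wx, of y]] m
    by auto
  moreover have "y \<noteq> w" using E antisymmetric by blast
  ultimately have yw: "(y, w) \<in> nonadjacent" using chordless E by blast
  show False
  proof (cases j)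
    case 0
    with v have "v = x" by simp
    with E xz yw show False using no_chordless_square by blast
  next
    case (Suc i)
    have "(z, v) \<notin> E"
      using shorter[of "Suc (Suc (Suc j))" x] m
        relpow_Suc_I2[OF E(1) relpow_Suc_I2[OF E(2) relpow_Suc_I2[OF _ v, of z]]] by auto
    moreover have "z \<noteq> v" using E antisymmetric by blast
    ultimately have zv: "(z, v) \<in> nonadjacent" using chordless E by blast
    \<comment> \<open>If \<open>x = v\<close>, the pairs \<open>(z, x)\<close> and
      \<open>(z, v)\<close> would coincide; but here the shortest cycle is longer than 4.\<close>
    have "(v, v) \<notin> E ^^ 4" using shorter[of 4 v] m Suc by simp
    then have "x \<noteq> v"
    proof (rule contrapos_nn)
      assume "x = v"
      then show "(v, v) \<in> E ^^ 4" using E by (auto simp: eval_nat_numeral)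
    qed
    let ?N = "{(x, z), (z, x), (y, w), (w, y), (z, v)}"
    have "x \<noteq> y" "y \<noteq> z" "z \<noteq> w" "w \<noteq> v" using E antisymmetric by blast+
    then have "card ?N = 5"
      using \<open>x \<noteq> z\<close> \<open>y \<noteq> w\<close> \<open>z \<noteq> v\<close> \<open>x \<noteq> v\<close> by auto
    moreover have "?N \<subseteq> nonadjacent" using xz yw zv sym_nonadjacent by (auto simp: sym_def)
    ultimately show False
      using card_nonadjacent_le card_mono[OF finite_nonadjacent, of ?N] by simp
  qed
qed

end

section \<open>Nonadjacent pairs in a topological order\<close>

text \<open>\<open>E\<close> is well-founded, so some vertex of \<open>V\<close> has no arc into it
  from \<open>V\<close>; it goes first and induction orders the rest.\<close>

lemma topological_enumeration:
  assumes "finite V" "finite E" "acyclic E"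
  shows "\<exists>xs. distinct xs \<and> set xs = V \<and> sorted_wrt (\<lambda>x y. (y, x) \<notin> E) xs"
  using assms(1)
proof (induction V rule: finite_psubset_induct)
  case (psubset V)
  show ?case
  proof (cases "V = {}")
    case False
    have "wf E" using assms finite_acyclic_wf by blast
    with False obtain z where z: "z \<in> V" "\<And>y. (y, z) \<in> E \<Longrightarrow> y \<notin> V"
      by (metis wfE_min ex_in_conv)
    from z(1) psubset.IH[of "V - {z}"] obtain xs where
      "distinct xs" "set xs = V - {z}" "sorted_wrt (\<lambda>x y. (y, x) \<notin> E) xs" by blast
    with z show ?thesis by (intro exI[of _ "z # xs"]) auto
  qed auto
qed

section \<open>Walks through a linear order that leave out some indices\<close>

lemma last_filter_upt:
  assumes "filter P [0..<n] \<noteq> []"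
  defines "l \<equiv> last (filter P [0..<n])"
  shows "l < n \<and> P l \<and> (\<forall>m. l < m \<and> m < n \<longrightarrow> \<not> P m)"
  using assms(1) unfolding l_def
proof (induction n)
  case (Suc n)
  show ?case
  proof (cases "P n")
    case False
    then have eq: "filter P [0..<Suc n] = filter P [0..<n]" by simp
    let ?l = "last (filter P [0..<n])"
    have "?l < n \<and> P ?l \<and> (\<forall>m. ?l < m \<and> m < n \<longrightarrow> \<not> P m)"
      using Suc.prems eq by (intro Suc.IH) simp
    then show ?thesis unfolding eq using False by (metis less_Suc_eq)
  qed auto
qed auto

lemma last_filter_upt_eq:
  assumes "P i" "i < n" "\<And>m. \<lbrakk>i < m; m < n\<rbrakk> \<Longrightarrow> \<not> P m"
  shows "last (filter P [0..<n]) = i"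
proof -
  have "i \<in> set (filter P [0..<n])" using assms by simp
  then have "filter P [0..<n] \<noteq> []" by (metis empty_iff list.set(1))
  from last_filter_upt[OF this] show ?thesis using assms by (meson nat_neq_iff)
qed

lemma hd_filter_upt_eq:
  assumes "P i" "i < n" "\<And>m. m < i \<Longrightarrow> \<not> P m"
  shows "hd (filter P [0..<n]) = i"
proof -
  have "[0..<n] = [0..<i] @ i # [Suc i..<n]"
    using upt_add_eq_append[of 0 i "n - i"] assms(2) by (simp add: upt_conv_Cons)
  moreover have "filter P [0..<i] = []" using assms(3) by (simp add: filter_empty_conv)
  ultimately show ?thesis using assms(1) by simp
qed

lemma successively_filter_upt:
  assumes "\<And>i j. \<lbrakk>i < j; j < n; P i; P j; \<And>m. \<lbrakk>i < m; m < j\<rbrakk> \<Longrightarrow> \<not> P m\<rbrakk> \<Longrightarrow> R i j"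
  shows "successively R (filter P [0..<n])"
  using assms
proof (induction n)
  case (Suc n)
  have "successively R (filter P [0..<n])"
    by (rule Suc.IH) (use Suc.prems in \<open>auto intro: less_SucI\<close>)
  moreover have "R (last (filter P [0..<n])) n" if "filter P [0..<n] \<noteq> []" "P n"
  proof -
    note l = last_filter_upt[OF that(1)]
    show ?thesis
    proof (rule Suc.prems)
      show "\<not> P m" if "last (filter P [0..<n]) < m" "m < n" for m using l that by blast
    qed (use l \<open>P n\<close> in blast)+
  qed
  ultimately show ?case by (auto simp: successively_append_iff)
qed auto

text \<open>The increasing enumeration of the indices outside \<open>S\<close> never steps directly along \<open>e\<close>.\<close>

definition bypass :: "nat set \<Rightarrow> nat \<times> nat \<Rightarrow> bool" where
  "bypass S e \<longleftrightarrow> fst e \<in> S \<or> snd e \<in> S \<or> (\<exists>m. fst e < m \<and> m < snd e \<and> m \<notin> S)"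

text \<open>The \<open>k + 1\<close> indices outside \<open>S\<close> form a walk of length
  \<open>k\<close>, since neither \<open>p\<close> nor \<open>q\<close> occurs as a step; uniqueness
  identifies the two walks and with them the omitted sets.\<close>

lemma (in unique_walks) skipping_unique:
  fixes xs :: "'a list"
  defines "remaining \<equiv> \<lambda>S. filter (\<lambda>i. i \<notin> S) [0..<k + 3]"
  assumes xs: "distinct xs" "length xs = k + 3"
    and arcs: "\<And>i j. \<lbrakk>i < j; j < k + 3; (i, j) \<notin> {p, q}\<rbrakk> \<Longrightarrow> (xs ! i, xs ! j) \<in> E"
    and S: "S \<subseteq> {..<k + 3}" "card S = 2" "bypass S p" "bypass S q"
    and S': "S' \<subseteq> {..<k + 3}" "card S' = 2" "bypass S' p" "bypass S' q"
    and ends: "hd (remaining S) = hd (remaining S')" "last (remaining S) = last (remaining S')"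
  shows "S = S'"
proof -
  have set_rem: "set (remaining X) = {..<k + 3} - X" for X
    by (auto simp: remaining_def)
  have len: "length (remaining X) = Suc k" if "X \<subseteq> {..<k + 3}" "card X = 2" for X
  proof -
    have "length (remaining X) = card (set (remaining X))"
      by (rule distinct_card[symmetric]) (simp add: remaining_def)
    also have "\<dots> = Suc k" using that finite_subset[OF that(1)] by (simp add: set_rem card_Diff_subset)
    finally show ?thesis .
  qed
  have walk: "walk E (map ((!) xs) (remaining X))" if "bypass X p" "bypass X q" for X
    unfolding successively_map remaining_def
  proof (rule successively_filter_upt)
    fix i j assume ij: "i < j" "j < k + 3" "i \<notin> X" "j \<notin> X" "\<And>m. \<lbrakk>i < m; m < j\<rbrakk> \<Longrightarrow> \<not> m \<notin> X"
    then have "(i, j) \<notin> {p, q}" using that by (auto simp: bypass_def)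
    with ij show "(xs ! i, xs ! j) \<in> E" by (intro arcs)
  qed
  have ne: "remaining S \<noteq> []" "remaining S' \<noteq> []"
    using len[OF S(1,2)] len[OF S'(1,2)] by auto
  have "map ((!) xs) (remaining S) = map ((!) xs) (remaining S')"
    using walk len S S' ends ne by (intro unique) (simp_all add: hd_map last_map)
  moreover have "inj_on ((!) xs) (set (remaining S) \<union> set (remaining S'))"
    using xs by (intro inj_on_nth) (auto simp: set_rem)
  ultimately have "remaining S = remaining S'" by (rule map_inj_on)
  then have "{..<k + 3} - S = {..<k + 3} - S'" using set_rem by metis
  then show ?thesis using S(1) S'(1) by blast
qed

text \<open>\<open>p\<close> and \<open>q\<close> may coincide. Unless they are the pairs at the two
  ends, there are two ways of leaving out two indices that bypass both and keep the same ends,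
  against \<open>skipping_unique\<close>.\<close>

lemma (in unique_long_walks) missing_pairs:
  fixes xs :: "'a list"
  assumes xs: "distinct xs" "length xs = k + 3"
    and arcs: "\<And>i j. \<lbrakk>i < j; j < k + 3; (i, j) \<notin> {p, q}\<rbrakk> \<Longrightarrow> (xs ! i, xs ! j) \<in> E"
    and p: "fst p < snd p" "snd p < k + 3" and q: "fst q < snd q" "snd q < k + 3"
  shows "{p, q} = {(0, 1), (k + 1, k + 2)}"
proof -
  have skip: "S = S'"
    if "S \<subseteq> {..<k + 3}" "card S = 2" "bypass S p" "bypass S q"
      "S' \<subseteq> {..<k + 3}" "card S' = 2" "bypass S' p" "bypass S' q"
      "hd (filter (\<lambda>i. i \<notin> S) [0..<k + 3]) = hd (filter (\<lambda>i. i \<notin> S') [0..<k + 3])"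
      "last (filter (\<lambda>i. i \<notin> S) [0..<k + 3]) = last (filter (\<lambda>i. i \<notin> S') [0..<k + 3])" for S S'
    by (rule skipping_unique[where p = p and q = q, OF xs _ that]) (rule arcs)
  \<comment> \<open>Only inner indices are left out, so both walks run from \<open>0\<close> to
    \<open>k + 2\<close>.\<close>
  have inner: "{x, y} = {x', y'}"
    if "{x, y, x', y'} \<subseteq> {1..k + 1}" "x \<noteq> y" "x' \<noteq> y'"
      "bypass {x, y} p" "bypass {x, y} q" "bypass {x', y'} p" "bypass {x', y'} q" for x y x' y'
  proof (rule skip)
    have "hd (filter (\<lambda>i. i \<notin> {v, w}) [0..<k + 3]) = 0"
      "last (filter (\<lambda>i. i \<notin> {v, w}) [0..<k + 3]) = k + 2" if "{v, w} \<subseteq> {1..k + 1}" for v w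
      using that by (intro hd_filter_upt_eq last_filter_upt_eq; auto)+
    then show "hd (filter (\<lambda>i. i \<notin> {x, y}) [0..<k + 3]) = hd (filter (\<lambda>i. i \<notin> {x', y'}) [0..<k + 3])"
      "last (filter (\<lambda>i. i \<notin> {x, y}) [0..<k + 3]) = last (filter (\<lambda>i. i \<notin> {x', y'}) [0..<k + 3])"
      using that(1) by simp_all
  qed (use that in auto)
  \<comment> \<open>Without the last index the walks end at \<open>k + 1\<close>, so the other
    omitted index is at most \<open>k\<close>.\<close>
  have drop_last: "x = y"
    if "{x, y} \<subseteq> {1..k}" "bypass {x, k + 2} p" "bypass {x, k + 2} q" "bypass {y, k + 2} p" "bypass {y, k + 2} q" for x y
  proof -
    have "{x, k + 2} = {y, k + 2}"
    proof (rule skip)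
      have "hd (filter (\<lambda>i. i \<notin> {v, k + 2}) [0..<k + 3]) = 0"
        "last (filter (\<lambda>i. i \<notin> {v, k + 2}) [0..<k + 3]) = k + 1" if "v \<in> {1..k}" for v
        using that by (intro hd_filter_upt_eq last_filter_upt_eq; auto)+
      then show "hd (filter (\<lambda>i. i \<notin> {x, k + 2}) [0..<k + 3]) = hd (filter (\<lambda>i. i \<notin> {y, k + 2}) [0..<k + 3])"
        "last (filter (\<lambda>i. i \<notin> {x, k + 2}) [0..<k + 3]) = last (filter (\<lambda>i. i \<notin> {y, k + 2}) [0..<k + 3])"
        using that(1) by simp_all
    qed (use that in auto)
    then show ?thesis using that by (auto simp: doubleton_eq_iff)
  qed
  have drop_first: "x = y"
    if "{x, y} \<subseteq> {2..k + 1}" "bypass {x, 0} p" "bypass {x, 0} q" "bypass {y, 0} p" "bypass {y, 0} q" for x y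
  proof -
    have "{x, 0} = {y, 0}"
    proof (rule skip)
      have "hd (filter (\<lambda>i. i \<notin> {v, 0}) [0..<k + 3]) = 1"
        "last (filter (\<lambda>i. i \<notin> {v, 0}) [0..<k + 3]) = k + 2" if "v \<in> {2..k + 1}" for v
        using that by (intro hd_filter_upt_eq last_filter_upt_eq; auto)+
      then show "hd (filter (\<lambda>i. i \<notin> {x, 0}) [0..<k + 3]) = hd (filter (\<lambda>i. i \<notin> {y, 0}) [0..<k + 3])"
        "last (filter (\<lambda>i. i \<notin> {x, 0}) [0..<k + 3]) = last (filter (\<lambda>i. i \<notin> {y, 0}) [0..<k + 3])"
        using that(1) by simp_all
    qed (use that in auto)
    then show ?thesis using that by (auto simp: doubleton_eq_iff)
  qed
  \<comment> \<open>The window starts at 1, or at 2 where index 1 has to stay.\<close>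
  have two_others: "\<exists>y y'. {y, y'} \<subseteq> {l..<l + 3} - {x} \<and> y \<noteq> y'" for l x :: nat
  proof -
    consider "x = l" | "x = l + 1" | "x \<noteq> l" "x \<noteq> l + 1" by blast
    then show ?thesis
    proof cases
      case 1 then show ?thesis by (intro exI[of _ "l + 1"] exI[of _ "l + 2"]) auto
    next
      case 2 then show ?thesis by (intro exI[of _ l] exI[of _ "l + 2"]) auto
    next
      case 3 then show ?thesis by (intro exI[of _ l] exI[of _ "l + 1"]) auto
    qed
  qed
  \<comment> \<open>If \<open>x\<close> alone deals with both pairs, the second omitted index is
    free, and two choices of it collide.\<close>
  have no_common: False
    if "x \<in> {1..k + 1}" "\<And>y. bypass {x, y} p" "\<And>y. bypass {x, y} q" for x
  proof -
    obtain y y' where y: "{y, y'} \<subseteq> {1..<1 + 3} - {x}" "y \<noteq> y'" using two_others by blast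
    then have "{x, y} = {x, y'}" using that k_ge by (intro inner) auto
    with y show False by (auto simp: doubleton_eq_iff)
  qed
  have long: "bypass {x, y} (0, k + 2)" for x y
  proof -
    obtain a b where ab: "{a, b} \<subseteq> {1..<1 + 3} - {x}" "a \<noteq> b" using two_others by blast
    obtain m where "m \<in> {1..<1 + 3} - {x}" "m \<noteq> y"
      using ab by (cases "a = y") auto
    then show ?thesis using k_ge unfolding bypass_def by (intro disjI2 exI[of _ m]) auto
  qed
  \<comment> \<open>Leaving out an inner end of \<open>r\<close> deals with it; the only pair
    without one, \<open>(0, k + 2)\<close>, is covered by \<open>long\<close>.\<close>
  have hit: "\<exists>x\<in>{1..k + 1}. \<forall>y. bypass {x, y} r" if r: "fst r < snd r" "snd r < k + 3" for r
  proof -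
    have "fst r \<ge> 1 \<or> snd r \<le> k + 1 \<or> fst r = 0 \<and> snd r = k + 2" using r by arith
    then consider "fst r \<ge> 1" | "snd r \<le> k + 1" | "r = (0, k + 2)" by (metis prod.collapse)
    then show ?thesis
    proof cases
      case 1 with r show ?thesis by (intro bexI[of _ "fst r"]) (auto simp: bypass_def)
    next
      case 2 with r show ?thesis by (intro bexI[of _ "snd r"]) (auto simp: bypass_def)
    next
      case 3 with long show ?thesis by (intro bexI[of _ 1]) auto
    qed
  qed
  \<comment> \<open>Two cases are excluded: \<open>(0, k + 2)\<close>, which every omission
    bypasses, and a pair with two inner ends, either of which can be left out along with an index
    that deals with \<open>s\<close>.\<close>
  have shape: "fst r = 0 \<and> snd r \<le> k + 1 \<or> 1 \<le> fst r \<and> snd r = k + 2"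
    if rs: "{r, s} = {p, q}" for r s
  proof (rule ccontr)
    assume not: "\<not> ?thesis"
    have r: "fst r < snd r" "snd r < k + 3" and s: "fst s < snd s" "snd s < k + 3"
      using rs p q by (auto simp: doubleton_eq_iff)
    have pq: "bypass X p" "bypass X q" if "bypass X r" "bypass X s" for X
      using that rs by (auto simp: doubleton_eq_iff)
    obtain x where x: "x \<in> {1..k + 1}" "\<And>y. bypass {x, y} s" using hit[OF s] by blast
    have nr: "\<not> (\<forall>y. bypass {x, y} r)" using no_common[OF x(1)] x(2) pq by blast
    then have "fst r \<noteq> x" "snd r \<noteq> x" by (auto simp: bypass_def)
    from nr have "r \<noteq> (0, k + 2)" using long by blast
    then have "\<not> (fst r = 0 \<and> snd r = k + 2)" by (metis prod.collapse)
    with not r have ri: "1 \<le> fst r" "snd r \<le> k + 1" by arith+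
    have "{x, fst r} = {x, snd r}"
      using x r ri \<open>fst r \<noteq> x\<close> \<open>snd r \<noteq> x\<close>
      by (intro inner pq x(2)) (auto simp: bypass_def)
    with r \<open>fst r \<noteq> x\<close> show False by (auto simp: doubleton_eq_iff)
  qed
  \<comment> \<open>If \<open>snd r \<noteq> 1\<close>, index 1 bypasses \<open>r\<close> as long as
    it stays; if \<open>fst s \<noteq> k + 1\<close>, index \<open>k + 1\<close> does the same for
    \<open>s\<close>. Only the other pair then restricts the choice, and two choices
    collide.\<close>
  have opposite: "r = (0, 1) \<and> s = (k + 1, k + 2)"
    if rs: "{r, s} = {p, q}" and ri: "fst r = 0" "snd r \<le> k + 1" and si: "1 \<le> fst s" "snd s = k + 2" for r s
  proof -
    have r: "fst r < snd r" and s: "fst s < snd s"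
      using rs p q by (auto simp: doubleton_eq_iff)
    have pq: "bypass X p" "bypass X q" if "bypass X r" "bypass X s" for X
      using that rs by (auto simp: doubleton_eq_iff)
    have "snd r = 1"
    proof (rule ccontr)
      assume "snd r \<noteq> 1"
      then have byr: "bypass {x, y} r" if "2 \<le> x" "2 \<le> y" for x y
        unfolding bypass_def using that r ri \<open>snd r \<noteq> 1\<close> by (intro disjI2 exI[of _ 1]) auto
      show False
      proof (cases "fst s = 1")
        case True
        \<comment> \<open>Leaving out \<open>fst s = 1\<close> would remove the index that bypasses
          \<open>r\<close>; instead 4 or 2 is kept inside the long gap of \<open>s\<close>.\<close>
        have "bypass {2, 3} s" unfolding bypass_def using True si k_ge by (intro disjI2 exI[of _ 4]) auto
        moreover have "bypass {3, 4} s" unfolding bypass_def using True si k_ge by (intro disjI2 exI[of _ 2]) auto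
        ultimately have "{2, 3} = {3, 4 :: nat}" using k_ge byr by (intro inner pq) auto
        then show False by (auto simp: doubleton_eq_iff)
      next
        case False
        obtain y y' where y: "{y, y'} \<subseteq> {2..<2 + 3} - {fst s}" "y \<noteq> y'" using two_others by blast
        then have "{fst s, y} = {fst s, y'}"
          using k_ge False s si by (intro inner pq byr) (auto simp: bypass_def)
        with y show False by (auto simp: doubleton_eq_iff)
      qed
    qed
    moreover have "fst s = k + 1"
    proof (rule ccontr)
      assume "fst s \<noteq> k + 1"
      then have bys: "bypass {x, y} s" if "x \<le> k" "y \<le> k" for x y
        unfolding bypass_def using that s si by (intro disjI2 exI[of _ "k + 1"]) auto
      have "snd r \<le> k" using \<open>snd r = 1\<close> k_ge by simp
      obtain y y' where y: "{y, y'} \<subseteq> {1..<1 + 3} - {snd r}" "y \<noteq> y'" using two_others by blast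
      then have "{snd r, y} = {snd r, y'}"
        using k_ge \<open>snd r \<le> k\<close> r ri by (intro inner pq bys) (auto simp: bypass_def)
      with y show False by (auto simp: doubleton_eq_iff)
    qed
    ultimately show ?thesis using ri si by (simp add: prod_eq_iff)
  qed
  have qp: "{q, p} = {p, q}" by (rule insert_commute)
  have "\<not> (fst p = 0 \<and> fst q = 0)"
  proof
    assume "fst p = 0 \<and> fst q = 0"
    \<comment> \<open>Leaving out index 0 deals with both pairs; 2 and 3 are two choices for the
      other index that keep the new start 1.\<close>
    then have "(2 :: nat) = 3" using k_ge by (intro drop_first) (auto simp: bypass_def)
    then show False by simp
  qed
  moreover have "\<not> (snd p = k + 2 \<and> snd q = k + 2)"
  proof
    assume "snd p = k + 2 \<and> snd q = k + 2"
    then have "(1 :: nat) = 2" using k_ge by (intro drop_last) (auto simp: bypass_def)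
    then show False by simp
  qed
  moreover have "fst q = 0 \<and> snd q \<le> k + 1 \<or> 1 \<le> fst q \<and> snd q = k + 2"
    by (rule shape[OF qp])
  ultimately consider "fst p = 0" "snd p \<le> k + 1" "1 \<le> fst q" "snd q = k + 2"
    | "fst q = 0" "snd q \<le> k + 1" "1 \<le> fst p" "snd p = k + 2"
    using shape[OF refl] by argo
  then show ?thesis
  proof cases
    case 1
    from opposite[OF refl 1] show ?thesis by simp
  next
    case 2
    from opposite[OF qp 2] show ?thesis by (simp add: insert_commute)
  qed
qed

section \<open>The arc set of F_n on the indices 0, ..., n-1\<close>

definition F_arcs :: "nat \<Rightarrow> nat rel" where
  "F_arcs n = {(i, j). i < j \<and> j < n \<and> (i, j) \<noteq> (0, 1) \<and> (i, j) \<noteq> (n - 2, n - 1)}"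

lemma card_increasing_pairs: "2 * card {(i, j). i < j \<and> j < n} + n = n * n" for n :: nat
proof -
  have "{(i, j). i < j \<and> j < n} = prod.swap ` (SIGMA j:{..<n}. {..<j})" by (auto simp: image_iff)
  then have "card {(i, j). i < j \<and> j < n} = card (SIGMA j:{..<n}. {..<j})"
    by (simp add: card_image)
  also have "\<dots> = (\<Sum>j<n. j)" by simp
  finally have "card {(i, j). i < j \<and> j < n} = (\<Sum>j<n. j)" .
  moreover have "2 * (\<Sum>j<n. j) + n = n * n" by (induction n) auto
  ultimately show ?thesis by simp
qed

lemma finite_increasing_pairs: "finite {(i, j). i < j \<and> j < n}" for n :: nat
  by (rule finite_subset[of _ "{..<n} \<times> {..<n}"]) auto

lemma card_F_arcs:
  assumes "n \<ge> 4"
  shows "2 * card (F_arcs n) + n + 4 = n * n"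
proof -
  let ?P = "{(i, j). i < j \<and> j < n}"
  have "F_arcs n = ?P - {(0, 1), (n - 2, n - 1)}" by (auto simp: F_arcs_def)
  moreover have "card {(0, 1), (n - 2, n - 1)} = 2" using assms by simp
  moreover have sub: "{(0, 1), (n - 2, n - 1)} \<subseteq> ?P" using assms by auto
  ultimately have "card (F_arcs n) = card ?P - 2" by (simp add: card_Diff_subset)
  moreover have "2 \<le> card ?P"
    using card_mono[OF finite_increasing_pairs sub] \<open>card {(0, 1), (n - 2, n - 1)} = 2\<close> by simp
  ultimately show ?thesis using card_increasing_pairs[of n] by linarith
qed

lemma finite_F_arcs: "finite (F_arcs n)"
  by (rule finite_subset[OF _ finite_increasing_pairs[of n]]) (auto simp: F_arcs_def)

lemma inj_on_nth_pairs:
  assumes "distinct xs" "length xs = n"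
  shows "inj_on (\<lambda>(i, j). (xs ! i, xs ! j)) {(i, j). i < j \<and> j < n}"
  using assms by (auto simp: inj_on_def nth_eq_iff_index_eq)

text \<open>In a topological order at most two increasing index pairs are nonarcs, by
  \<open>dense\<close>; \<open>missing_pairs\<close> identifies them.\<close>

lemma (in dense_unique_walks) extremal_enumeration:
  "\<exists>xs. distinct xs \<and> set xs = V \<and> E = (\<lambda>(i, j). (xs ! i, xs ! j)) ` F_arcs (k + 3)"
proof -
  obtain xs where xs: "distinct xs" "set xs = V" "sorted_wrt (\<lambda>x y. (y, x) \<notin> E) xs"
    using topological_enumeration[OF finite_V finite_E acyclic_E] by blast
  have len: "length xs = k + 3" using xs card_V by (simp flip: distinct_card)
  let ?h = "\<lambda>(i, j). (xs ! i, xs ! j)"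
  let ?P = "{(i, j). i < j \<and> j < k + 3}"
  define N where "N = {e \<in> ?P. ?h e \<notin> E}"
  have "E \<subseteq> ?h ` ?P"
  proof
    fix e assume "e \<in> E"
    obtain x y where e: "e = (x, y)" by fastforce
    with \<open>e \<in> E\<close> E_subset xs(2) obtain i j where ij: "i < k + 3" "j < k + 3" "x = xs ! i" "y = xs ! j"
      using len by (metis SigmaE2 in_set_conv_nth subsetD)
    have "\<not> j < i" using sorted_wrt_nth_less[OF xs(3), of j i] ij \<open>e \<in> E\<close> e len by auto
    moreover have "i \<noteq> j" using antisymmetric[of x x] \<open>e \<in> E\<close> e ij by auto
    ultimately show "e \<in> ?h ` ?P" using e ij by (intro image_eqI[of _ _ "(i, j)"]) auto
  qed
  then have E_eq: "E = ?h ` (?P - N)" by (auto simp: N_def)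
  have "N \<subseteq> ?P" by (auto simp: N_def)
  then have "finite N" using finite_increasing_pairs finite_subset by blast
  have "card E = card (?P - N)"
    unfolding E_eq using inj_on_nth_pairs[OF xs(1) len]
    by (intro card_image) (rule inj_on_subset, auto)
  then have "card E + card N = card ?P"
    using card_Diff_subset[OF \<open>finite N\<close> \<open>N \<subseteq> ?P\<close>] card_mono[OF finite_increasing_pairs \<open>N \<subseteq> ?P\<close>]
    by simp
  then have "card N \<le> 2" using dense card_V card_increasing_pairs[of "k + 3"] by simp
  \<comment> \<open>With fewer than two nonarcs \<open>p = q\<close> covers \<open>N\<close>; the
    two-element conclusion of \<open>missing_pairs\<close> then rules this case out.\<close>
  have "\<exists>p q. {p, q} \<subseteq> ?P \<and> N \<subseteq> {p, q} \<and> (p = q \<or> N = {p, q})"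
  proof -
    consider "card N = 0" | "card N = 1" | "card N = 2" using \<open>card N \<le> 2\<close> by linarith
    then show ?thesis
    proof cases
      case 1
      then have "N = {}" using \<open>finite N\<close> by simp
      then show ?thesis by (intro exI[of _ "(0, 1)"]) auto
    next
      case 2
      then obtain p where "N = {p}" by (rule card_1_singletonE)
      then show ?thesis using \<open>N \<subseteq> ?P\<close> by (intro exI[of _ p]) auto
    next
      case 3
      then obtain p q where "N = {p, q}" by (auto simp: card_2_iff)
      then show ?thesis using \<open>N \<subseteq> ?P\<close> by (intro exI[of _ p] exI[of _ q]) auto
    qed
  qed
  then obtain p q where pq: "{p, q} \<subseteq> ?P" "N \<subseteq> {p, q}" "p = q \<or> N = {p, q}"
    by (elim exE conjE)
  have eq: "{p, q} = {(0, 1), (k + 1, k + 2)}"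
  proof (rule missing_pairs[OF xs(1) len])
    show "(xs ! i, xs ! j) \<in> E" if "i < j" "j < k + 3" "(i, j) \<notin> {p, q}" for i j
      using that pq(2) by (auto simp: N_def)
    have "p \<in> ?P" "q \<in> ?P" using pq(1) by simp_all
    then show "fst p < snd p" "snd p < k + 3" "fst q < snd q" "snd q < k + 3"
      by (simp_all add: case_prod_beta)
  qed
  have "card {p, q} = 2" unfolding eq by simp
  then have "p \<noteq> q" by auto
  with pq(3) eq have N: "N = {(0, 1), (k + 1, k + 2)}" by simp
  have "?P - N = F_arcs (k + 3)" unfolding N F_arcs_def by auto
  then show ?thesis using E_eq xs(1,2) by blast
qed

section \<open>Extremality of \<open>F_mat\<close>\<close>

text \<open>A walk with \<open>k\<close> arcs climbs through the levels 0, ..., \<open>k\<close> one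
  at a time. Its inner vertices are fixed by their levels, its ends by assumption.\<close>

lemma level_unique_walks:
  fixes level :: "'a \<Rightarrow> nat"
  assumes level: "\<And>x y. (x, y) \<in> E \<Longrightarrow> level x < level y \<and> level y \<le> k"
    and inner: "\<And>x y. \<lbrakk>x \<in> Field E; y \<in> Field E; level x = level y; 0 < level x; level x < k\<rbrakk> \<Longrightarrow> x = y"
    and "k > 0"
  shows "unique_walks E k"
proof
  have member: "x \<in> Field E" if "walk E p" "length p = Suc k" "x \<in> set p" for p x
  proof -
    from that(3) obtain i where i: "i < length p" "x = p ! i" by (auto simp: in_set_conv_nth)
    show ?thesis
    proof (cases i)
      case 0
      then have "(x, p ! 1) \<in> E" using successively_nth[OF that(1), of 0] that(2) i \<open>k > 0\<close> by simp
      then show ?thesis by (auto simp: Field_def)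
    next
      case (Suc j)
      then have "(p ! j, x) \<in> E" using successively_nth[OF that(1), of j] i by simp
      then show ?thesis by (auto simp: Field_def)
    qed
  qed
  have levels: "map level p = [0..<Suc k]" if p: "walk E p" "length p = Suc k" for p
  proof -
    have "successively (<) (map level p)"
      unfolding successively_map by (rule successively_mono[OF p(1)]) (use level in blast)
    then have sorted: "sorted_wrt (<) (map level p)"
      by (subst (asm) successively_conv_sorted_wrt) (auto intro: transpI)
    have "x \<in> Field E \<Longrightarrow> level x \<le> k" for x
      using level by (fastforce simp: Field_def)
    then have "set (map level p) \<subseteq> {..k}" using member[OF p] by auto
    moreover have "card (set (map level p)) = Suc k"
      using sorted p(2) by (metis distinct_card length_map strict_sorted_iff)
    ultimately have "set (map level p) = {..k}" by (intro card_seteq) auto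
    then show ?thesis using sorted
      by (intro strict_sorted_equal) (simp_all del: upt_Suc add: atLeast0LessThan lessThan_Suc_atMost)
  qed
  fix p q
  assume p: "walk E p" "length p = Suc k" and q: "walk E q" "length q = Suc k"
    and ends: "hd p = hd q" "last p = last q"
  show "p = q"
  proof (rule nth_equalityI)
    fix i assume "i < length p"
    then consider "i = 0" | "i = k" | "0 < i" "i < k" using p(2) by linarith
    then show "p ! i = q ! i"
    proof cases
      case 1
      then show ?thesis using ends(1) p(2) q(2) by (metis hd_conv_nth list.size(3) nat.distinct(1))
    next
      case 2
      then show ?thesis using ends(2) p(2) q(2)
        by (metis diff_Suc_1 last_conv_nth list.size(3) nat.distinct(1))
    next
      case 3
      have "level (p ! i) = i" "level (q ! i) = i"
        using levels[OF p] levels[OF q] 3 p(2) q(2)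
        by (metis nth_map nth_upt add_0 less_SucI)+
      then show ?thesis using 3 p q by (intro inner member[OF p] member[OF q]) auto
    qed
  qed (use p(2) q(2) in simp)
qed

lemma unique_walks_F_arcs:
  assumes "distinct xs" "length xs = n" "n \<ge> 4"
  shows "unique_walks ((\<lambda>(i, j). (xs ! i, xs ! j)) ` F_arcs n) (n - 3)"
proof -
  let ?E = "(\<lambda>(i, j). (xs ! i, xs ! j)) ` F_arcs n"
  define index where "index = inv_into {..<n} ((!) xs)"
  have index: "index (xs ! i) = i" if "i < n" for i
    using that inj_on_nth[OF assms(1)] assms(2) unfolding index_def by (intro inv_into_f_f) auto
  \<comment> \<open>The first two vertices share level 0 and the last two share level \<open>n - 3\<close>.\<close>
  define level where "level x = (if index x = n - 1 then n - 3 else index x - 1)" for x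
  show ?thesis
  proof (rule level_unique_walks[where level = level])
    show "level x < level y \<and> level y \<le> n - 3" if xy: "(x, y) \<in> ?E" for x y
    proof -
      from xy obtain i j where ij: "x = xs ! i" "y = xs ! j" "i < j" "j < n"
        "(i, j) \<noteq> (0, 1)" "(i, j) \<noteq> (n - 2, n - 1)"
        by (auto simp: F_arcs_def)
      \<comment> \<open>A tail has \<open>i < n - 1\<close>, so the second branch applies; truncated
        subtraction sends 0 and 1 to level 0.\<close>
      have "level x = i - 1" using ij index[of i] by (auto simp: level_def)
      moreover have "level y = (if j = n - 1 then n - 3 else j - 1)"
        using ij index[of j] by (simp add: level_def)
      ultimately show ?thesis using ij assms(3) by auto
    qed
    show "x = y" if xy: "x \<in> Field ?E" "y \<in> Field ?E" "level x = level y" "0 < level x" "level x < n - 3" for x y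
    proof -
      have "?E \<subseteq> (!) xs ` {..<n} \<times> (!) xs ` {..<n}" by (auto simp: F_arcs_def)
      then have "Field ?E \<subseteq> (!) xs ` {..<n}" by (force simp: Field_def)
      then obtain i j where ij: "i < n" "x = xs ! i" "j < n" "y = xs ! j" using xy by blast
      then have "level x = (if i = n - 1 then n - 3 else i - 1)" "level y = (if j = n - 1 then n - 3 else j - 1)"
        using index by (auto simp: level_def)
      then have "i = j" using xy(3-5) by (auto split: if_splits)
      with ij show ?thesis by simp
    qed
  qed (use assms in simp)
qed

section \<open>From digraphs to their arc relations\<close>

lemma set_vwalk_arcs_subset_iff: "set (vwalk_arcs p) \<subseteq> E \<longleftrightarrow> walk E p"
  by (induction p rule: vwalk_arcs.induct) auto

text \<open>Since \<open>k > 0\<close>, every vertex of the list is an end of an arc and so lies in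
  \<open>pverts D\<close>.\<close>

lemma walk_of_length_iff:
  assumes "pair_fin_digraph D" "k > 0"
  shows "walk_of_length D k u v p \<longleftrightarrow>
    walk (parcs D) p \<and> length p = Suc k \<and> hd p = u \<and> last p = v"
proof -
  interpret pair_fin_digraph D by fact
  have sub: "set p \<subseteq> pverts D" if "walk (parcs D) p" "length p = Suc k"
  proof
    fix x assume "x \<in> set p"
    then obtain i where i: "i < length p" "x = p ! i" by (auto simp: in_set_conv_nth)
    show "x \<in> pverts D"
    proof (cases i)
      case 0
      then have "(x, p ! 1) \<in> parcs D" using successively_nth[OF that(1), of 0] that(2) i \<open>k > 0\<close> by simp
      then show ?thesis using arc_fst_in_verts by fastforce
    next
      case (Suc j)
      then have "(p ! j, x) \<in> parcs D" using successively_nth[OF that(1), of j] i by simp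
      then show ?thesis using arc_snd_in_verts by fastforce
    qed
  qed
  have ends: "arcs_ends (with_proj D) = parcs D"
    by (auto simp: arcs_ends_def arc_to_ends_def)
  have len: "length p - 1 = k \<and> p \<noteq> [] \<longleftrightarrow> length p = Suc k"
    using \<open>k > 0\<close> by (cases p) auto
  show ?thesis
    unfolding walk_of_length_def vwalk_def vwalk_length_simp ends set_vwalk_arcs_subset_iff
    using sub len by auto
qed

lemma walk_free_iff:
  assumes "pair_fin_digraph D" "k > 0"
  shows "walk_free k D \<longleftrightarrow> unique_walks (parcs D) k"
proof
  interpret pair_fin_digraph D by fact
  assume free: "walk_free k D"
  show "unique_walks (parcs D) k"
  proof
    fix p q
    assume *: "walk (parcs D) p" "walk (parcs D) q" "length p = Suc k" "length q = Suc k"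
      "hd p = hd q" "last p = last q"
    then have w: "walk_of_length D k (hd p) (last p) p" "walk_of_length D k (hd p) (last p) q"
      using walk_of_length_iff[OF assms] by auto
    then have "set p \<subseteq> pverts D" "p \<noteq> []" by (auto simp: walk_of_length_def vwalk_def)
    then have "hd p \<in> pverts D" "last p \<in> pverts D" by auto
    then have "\<exists>\<^sub>\<le>\<^sub>1 p'. walk_of_length D k (hd p) (last p) p'" using free by (simp add: walk_free_def)
    with w show "p = q" by (auto simp: Uniq_def)
  qed
next
  assume "unique_walks (parcs D) k"
  then interpret unique_walks "parcs D" k .
  show "walk_free k D"
    unfolding walk_free_def Uniq_def walk_of_length_iff[OF assms] by (auto intro: unique)
qed

section \<open>From matrices to vertex orders\<close>

lemma F_mat_carrier: "n \<ge> 4 \<Longrightarrow> F_mat n \<in> carrier_mat n n"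
  by (auto simp: F_mat_def T_mat_def J_mat_def)

lemma F_mat_index:
  assumes "n \<ge> 4" "i < n" "j < n"
  shows "F_mat n $$ (i, j) = (if (i, j) \<in> F_arcs n then 1 else 0)"
  using assms by (auto simp: F_mat_def T_mat_def J_mat_def F_arcs_def)

text \<open>Row \<open>i\<close> of \<open>permutation_mat n \<pi>\<close> is the unit vector at
  \<open>\<pi> i\<close>, so both sums collapse to one term.\<close>

lemma permutation_mat_conjugate_index:
  assumes "A \<in> carrier_mat n n" "\<pi> permutes {..<n}" "i < n" "j < n"
  shows "(permutation_mat n \<pi> * A * transpose_mat (permutation_mat n \<pi>)) $$ (i, j) = A $$ (\<pi> i, \<pi> j)"
proof -
  let ?P = "permutation_mat n \<pi>"
  have P: "?P \<in> carrier_mat n n" by (simp add: permutation_mat_def)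
  have \<pi>: "\<pi> i < n" "\<pi> j < n" using assms permutes_in_image[OF assms(2)] by auto
  have left: "(?P * A) $$ (i, l) = A $$ (\<pi> i, l)" if "l < n" for l
  proof -
    have "(?P * A) $$ (i, l) = (\<Sum>m\<in>{0..<n}. (if m = \<pi> i then 1 else 0) * A $$ (m, l))"
      using assms that P by (auto simp: scalar_prod_def permutation_mat_def intro!: sum.cong)
    also have "\<dots> = (\<Sum>m\<in>{0..<n}. if m = \<pi> i then A $$ (m, l) else 0)"
      by (intro sum.cong) auto
    also have "\<dots> = A $$ (\<pi> i, l)" using \<pi> by (simp add: sum.delta)
    finally show ?thesis .
  qed
  have "(?P * A * transpose_mat ?P) $$ (i, j)
      = (\<Sum>m\<in>{0..<n}. (?P * A) $$ (i, m) * (if m = \<pi> j then 1 else 0))"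
    using assms P by (auto simp: scalar_prod_def permutation_mat_def simp del: index_mult_mat(1) intro!: sum.cong)
      (auto simp: scalar_prod_def)
  also have "\<dots> = (\<Sum>m\<in>{0..<n}. if m = \<pi> j then A $$ (\<pi> i, m) else 0)"
    using left by (intro sum.cong) auto
  also have "\<dots> = A $$ (\<pi> i, \<pi> j)" using \<pi> by (simp add: sum.delta)
  finally show ?thesis .
qed

text \<open>Conjugating by a permutation matrix amounts to reordering the vertex list, with
  \<open>xs = permute_list \<pi> vs\<close>.\<close>

lemma permutation_similar_F_mat_iff:
  fixes D :: "'a pair_pre_digraph"
  assumes D: "pair_fin_digraph D" and vs: "distinct vs" "set vs = pverts D" and n: "n \<ge> 4"
  shows "permutation_similar (adjacency_mat D vs) (F_mat n) \<longleftrightarrow>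
    (\<exists>xs. distinct xs \<and> set xs = pverts D \<and> length xs = n \<and>
      parcs D = (\<lambda>(i, j). (xs ! i, xs ! j)) ` F_arcs n)"
    (is "?L \<longleftrightarrow> ?R")
proof
  interpret pair_fin_digraph D by fact
  let ?A = "adjacency_mat D vs"
  assume ?L
  then obtain m \<pi> where m: "?A \<in> carrier_mat m m" "F_mat n \<in> carrier_mat m m" "\<pi> permutes {..<m}"
    "F_mat n = permutation_mat m \<pi> * ?A * transpose_mat (permutation_mat m \<pi>)"
    unfolding permutation_similar_def by blast
  have "m = n" using m(2) F_mat_carrier[OF n] by auto
  have len: "length vs = n" using m(1) \<open>m = n\<close> by (auto simp: adjacency_mat_def)
  note \<pi> = m(3)[unfolded \<open>m = n\<close>]
  have arcs: "(i, j) \<in> F_arcs n \<longleftrightarrow> (vs ! \<pi> i, vs ! \<pi> j) \<in> parcs D" if "i < n" "j < n" for i j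
  proof -
    have "\<pi> i < n" "\<pi> j < n" using that permutes_in_image[OF \<pi>] by auto
    moreover have "F_mat n $$ (i, j) = ?A $$ (\<pi> i, \<pi> j)"
      using permutation_mat_conjugate_index[OF m(1,3)] m(4) that \<open>m = n\<close> by simp
    ultimately show ?thesis
      using F_mat_index[OF n that] len by (auto simp: adjacency_mat_def split: if_splits)
  qed
  have "\<pi> permutes {..<length vs}" using \<pi> len by simp
  note perm = permute_list_nth[OF this] set_permute_list[OF this] distinct_permute_list[OF this]
  define xs where "xs = permute_list \<pi> vs"
  have xs: "distinct xs" "set xs = pverts D" "length xs = n"
    using vs len perm(2,3) by (simp_all add: xs_def)
  have arcs': "(i, j) \<in> F_arcs n \<longleftrightarrow> (xs ! i, xs ! j) \<in> parcs D" if "i < n" "j < n" for i j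
    using arcs[OF that] that len by (simp add: xs_def perm(1))
  have "parcs D = (\<lambda>(i, j). (xs ! i, xs ! j)) ` F_arcs n"
  proof (intro equalityI subsetI)
    fix e assume e: "e \<in> parcs D"
    then have "fst e \<in> set xs" "snd e \<in> set xs"
      using arc_fst_in_verts arc_snd_in_verts xs(2) by auto
    then obtain i j where ij: "i < n" "j < n" "fst e = xs ! i" "snd e = xs ! j"
      using xs(3) by (metis in_set_conv_nth)
    then have "e = (xs ! i, xs ! j)" by (simp add: prod_eq_iff)
    then show "e \<in> (\<lambda>(i, j). (xs ! i, xs ! j)) ` F_arcs n"
      using arcs'[OF ij(1,2)] e by (intro image_eqI[of _ _ "(i, j)"]) simp_all
  next
    fix e assume "e \<in> (\<lambda>(i, j). (xs ! i, xs ! j)) ` F_arcs n"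
    then obtain i j where "(i, j) \<in> F_arcs n" "e = (xs ! i, xs ! j)" by auto
    then show "e \<in> parcs D" using arcs'[of i j] by (auto simp: F_arcs_def)
  qed
  with xs show ?R by blast
next
  let ?A = "adjacency_mat D vs"
  assume ?R
  then obtain xs where xs: "distinct xs" "set xs = pverts D" "length xs = n"
    "parcs D = (\<lambda>(i, j). (xs ! i, xs ! j)) ` F_arcs n" by blast
  have "mset xs = mset vs" using set_eq_iff_mset_eq_distinct[of xs vs] xs(1,2) vs by simp
  then obtain \<pi> where \<pi>: "\<pi> permutes {..<length vs}" "permute_list \<pi> vs = xs"
    by (rule mset_eq_permutation)
  have len: "length vs = n" using \<pi>(2) xs(3) by auto
  note \<pi>n = \<pi>(1)[unfolded len]
  have A: "?A \<in> carrier_mat n n" using len by (simp add: adjacency_mat_def)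
  have "F_mat n = permutation_mat n \<pi> * ?A * transpose_mat (permutation_mat n \<pi>)"
  proof (rule eq_matI)
    show "dim_row (F_mat n) = dim_row (permutation_mat n \<pi> * ?A * transpose_mat (permutation_mat n \<pi>))"
      "dim_col (F_mat n) = dim_col (permutation_mat n \<pi> * ?A * transpose_mat (permutation_mat n \<pi>))"
      using F_mat_carrier[OF n] by (simp_all add: permutation_mat_def)
  next
    fix i j
    assume "i < dim_row (permutation_mat n \<pi> * ?A * transpose_mat (permutation_mat n \<pi>))"
      "j < dim_col (permutation_mat n \<pi> * ?A * transpose_mat (permutation_mat n \<pi>))"
    then have ij: "i < n" "j < n" by (simp_all add: permutation_mat_def)
    then have \<pi>ij: "\<pi> i < n" "\<pi> j < n" using permutes_in_image[OF \<pi>n] by auto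
    have nth: "xs ! i = vs ! \<pi> i" "xs ! j = vs ! \<pi> j"
      using permute_list_nth[OF \<pi>(1)] \<pi>(2) ij len by auto
    have "(xs ! i, xs ! j) \<in> parcs D \<longleftrightarrow> (i, j) \<in> F_arcs n"
    proof
      assume "(xs ! i, xs ! j) \<in> parcs D"
      then obtain a b where "(a, b) \<in> F_arcs n" "xs ! i = xs ! a" "xs ! j = xs ! b"
        unfolding xs(4) by auto
      moreover then have "a < n" "b < n" by (auto simp: F_arcs_def)
      ultimately show "(i, j) \<in> F_arcs n" using ij xs(1,3) by (simp add: nth_eq_iff_index_eq)
    next
      assume "(i, j) \<in> F_arcs n"
      then show "(xs ! i, xs ! j) \<in> parcs D" unfolding xs(4) by (intro image_eqI[of _ _ "(i, j)"]) auto
    qed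
    then show "F_mat n $$ (i, j)
        = (permutation_mat n \<pi> * ?A * transpose_mat (permutation_mat n \<pi>)) $$ (i, j)"
      using F_mat_index[OF n ij] permutation_mat_conjugate_index[OF A \<pi>n ij] \<pi>ij nth len
      by (simp add: adjacency_mat_def)
  qed
  with A F_mat_carrier[OF n] \<pi>n show ?L unfolding permutation_similar_def by blast
qed

section \<open>The extremal number and the extremal digraphs\<close>

lemma card_nth_image_F_arcs:
  assumes "distinct xs" "length xs = n"
  shows "card ((\<lambda>(i, j). (xs ! i, xs ! j)) ` F_arcs n) = card (F_arcs n)"
  by (intro card_image inj_on_subset[OF inj_on_nth_pairs[OF assms]]) (auto simp: F_arcs_def)

text \<open>\<open>card_F_arcs\<close> turns the assumed number of arcs into \<open>dense\<close>
  with \<open>k = n - 3\<close>. Both the upper bound and the uniqueness rest on this.\<close>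

lemma free_digraph_extremal:
  assumes "n \<ge> 7" "D \<in> free_digraphs n (n - 3)" "card (F_arcs n) \<le> card (parcs D)"
  shows "\<exists>xs. distinct xs \<and> set xs = pverts D \<and> length xs = n \<and>
    parcs D = (\<lambda>(i, j). (xs ! i, xs ! j)) ` F_arcs n"
proof -
  from assms(2) have D: "pair_fin_digraph D" "card (pverts D) = n" "walk_free (n - 3) D"
    by (auto simp: free_digraphs_def)
  interpret D: pair_fin_digraph D by fact
  interpret unique_walks "parcs D" "n - 3"
    using walk_free_iff[OF D(1)] D(3) assms(1) by simp
  interpret dense_unique_walks "parcs D" "n - 3" "pverts D"
  proof
    show "parcs D \<subseteq> pverts D \<times> pverts D"
      using D.arc_fst_in_verts D.arc_snd_in_verts by fastforce
    show "card (pverts D) * card (pverts D) \<le> 2 * card (parcs D) + card (pverts D) + 4"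
      using card_F_arcs[of n] assms D(2) by simp
  qed (use assms D D.pair_finite_verts in auto)
  from extremal_enumeration obtain xs where
    "distinct xs" "set xs = pverts D" "parcs D = (\<lambda>(i, j). (xs ! i, xs ! j)) ` F_arcs n"
    using assms(1) by auto
  then show ?thesis using D(2) by (metis distinct_card)
qed

lemma free_digraphI:
  assumes "n \<ge> 7" "pair_fin_digraph D" "distinct xs" "set xs = pverts D" "length xs = n"
    "parcs D = (\<lambda>(i, j). (xs ! i, xs ! j)) ` F_arcs n"
  shows "D \<in> free_digraphs n (n - 3)" "card (parcs D) = card (F_arcs n)"
proof -
  have "unique_walks (parcs D) (n - 3)"
    unfolding assms(6) by (rule unique_walks_F_arcs) (use assms in auto)
  then show "D \<in> free_digraphs n (n - 3)"
    using assms walk_free_iff[of D "n - 3"] distinct_card[of xs] by (auto simp: free_digraphs_def)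
  show "card (parcs D) = card (F_arcs n)"
    using card_nth_image_F_arcs assms by metis
qed

text \<open>A digraph with more arcs would still fall under \<open>free_digraph_extremal\<close>,
  which gives it exactly \<open>card (F_arcs n)\<close> arcs.\<close>

lemma card_free_digraph_le:
  assumes "n \<ge> 7" "D \<in> free_digraphs n (n - 3)"
  shows "card (parcs D) \<le> card (F_arcs n)"
proof (rule ccontr)
  assume "\<not> ?thesis"
  with free_digraph_extremal[OF assms] obtain xs where "distinct xs" "length xs = n"
    "parcs D = (\<lambda>(i, j). (xs ! i, xs ! j)) ` F_arcs n" by auto
  with card_nth_image_F_arcs[of xs n] \<open>\<not> ?thesis\<close> show False by simp
qed

lemma ex_number_eq:
  assumes "n \<ge> 7"
  shows "ex_number n (n - 3) = card (F_arcs n)"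
  unfolding ex_number_def
proof (rule Max_eqI)
  let ?S = "(\<lambda>D :: nat pair_pre_digraph. card (parcs D)) ` free_digraphs n (n - 3)"
  show le: "m \<le> card (F_arcs n)" if "m \<in> ?S" for m
    using that card_free_digraph_le[OF assms] by auto
  \<comment> \<open>Infinitely many digraphs on the naturals qualify, but their arc counts are
    bounded.\<close>
  then show "finite ?S" by (intro finite_subset[of ?S "{..card (F_arcs n)}"]) auto
  \<comment> \<open>F_n on the vertices 0, ..., n-1 attains the bound.\<close>
  let ?D = "\<lparr>pverts = {..<n}, parcs = F_arcs n\<rparr>"
  have "pair_fin_digraph ?D"
    by unfold_locales (use finite_F_arcs in \<open>auto simp: F_arcs_def\<close>)
  moreover have "parcs ?D = (\<lambda>(i, j). ([0..<n] ! i, [0..<n] ! j)) ` F_arcs n"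
    by (force simp: F_arcs_def)
  ultimately have "?D \<in> free_digraphs n (n - 3)" "card (parcs ?D) = card (F_arcs n)"
    using free_digraphI[OF assms, of ?D "[0..<n]"] by (simp_all add: lessThan_atLeast0)
  then show "card (F_arcs n) \<in> ?S" by (metis image_eqI)
qed

theorem theorem8:
  fixes n :: nat
  assumes "n \<ge> 7"
  shows "real (ex_number n (n - 3)) = real n * (real n - 1) / 2 - 2 \<and>
    (\<forall>(D :: 'a pair_pre_digraph) vs.
       pair_fin_digraph D \<and> distinct vs \<and> set vs = pverts D \<longrightarrow>
       (D \<in> Ex_set n (n - 3) \<longleftrightarrow> permutation_similar (adjacency_mat D vs) (F_mat n)))"
proof (intro conjI allI impI)
  have "2 * card (F_arcs n) + n + 4 = n * n" by (rule card_F_arcs) (use assms in simp)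
  then have "real (2 * card (F_arcs n) + n + 4) = real (n * n)" by (rule arg_cong)
  then show "real (ex_number n (n - 3)) = real n * (real n - 1) / 2 - 2"
    by (simp add: ex_number_eq[OF assms] field_simps)
next
  fix D :: "'a pair_pre_digraph" and vs
  assume D: "pair_fin_digraph D \<and> distinct vs \<and> set vs = pverts D"
  have "D \<in> Ex_set n (n - 3) \<longleftrightarrow> (\<exists>xs. distinct xs \<and> set xs = pverts D \<and> length xs = n \<and>
      parcs D = (\<lambda>(i, j). (xs ! i, xs ! j)) ` F_arcs n)"
    unfolding Ex_set_def ex_number_eq[OF assms]
    using free_digraph_extremal[OF assms, of D] free_digraphI[OF assms, of D] D by auto
  then show "D \<in> Ex_set n (n - 3) \<longleftrightarrow> permutation_similar (adjacency_mat D vs) (F_mat n)"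
    using permutation_similar_F_mat_iff[of D vs n] D assms by simp
qed

end
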